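(* Let $n\ge1$, $d\ge1$, let $c$ be a Coxeter element of $W(A_n)=S_{n+1}$, let $T_i=A_1^{m_1^{(i)}}*A_2^{m_2^{(i)}}*\dots*A_n^{m_n^{(i)}}$, $i=1,\dots,d$, be types, and let $l,m_1,\dots,m_l,s_1,\dots,s_l$ be non-negative integers with $\operatorname{rk}T_1+\dots+\operatorname{rk}T_d+s_1+\dots+s_l=n$. Then the number of factorisations $$c=\sigma_1\sigma_2\cdots\sigma_d\,\sigma_1^{(1)}\cdots\sigma_{m_1}^{(1)}\,\sigma_1^{(2)}\cdots\sigma_{m_2}^{(2)}\cdots\sigma_1^{(l)}\cdots\sigma_{m_l}^{(l)}$$ in $W(A_n)$ such that $\sigma_i$ has type $T_i$ ($i=1,\dots,d$) and $\ell_T(\sigma_1^{(i)})+\dots+\ell_T(\sigma_{m_i}^{(i)})=s_i$ ($i=1,\dots,l$) equals $$(n+1)^{d-1}\Bigg(\prod_{i=1}^{d}\frac{1}{n-\operatorname{rk}T_i+1}\binom{n-\operatorname{rk}T_i+1}{m_1^{(i)},\dots,m_n^{(i)}}\Bigg)\binom{m_1(n+1)}{s_1}\binom{m_2(n+1)}{s_2}\cdots\binom{m_l(n+1)}{s_l}.$$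
   Context: $W(A_n)$ is the symmetric group $S_{n+1}$ with reflections the transpositions; $\ell_T(w)$ is the minimal number of transpositions whose product is $w$ (equal to $n+1$ minus the number of cycles of $w$). Coxeter elements are the $(n+1)$-cycles. The type of a permutation (as a parabolic Coxeter element) is $A_1^{m_1}*A_2^{m_2}*\dots*A_n^{m_n}$, where $m_k$ is the number of its cycles of length $k+1$; its rank is $\sum_k k\,m_k$. Multinomial coefficient: $\binom{M}{m_1,\dots,m_r}=\frac{M!}{m_1!\cdots m_r!(M-m_1-\dots-m_r)!}$. *)

theory Defs
  imports Complex_Main "HOL-Combinatorics.Combinatorics"
begin

text \<open>
  The group \<open>W(A\<^sub>n)\<close> is realised as the group of permutations of \<open>{1..n+1}\<close>
  (functions \<open>nat \<Rightarrow> nat\<close> fixing every other number), with product \<open>\<circ>\<close>.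
\<close>

definition W_A :: "nat \<Rightarrow> (nat \<Rightarrow> nat) set" where
  "W_A n = {w. w permutes {1..n+1}}"

definition reflections_A :: "nat \<Rightarrow> (nat \<Rightarrow> nat) set" where
  "reflections_A n = {transpose a b | a b. a \<in> {1..n+1} \<and> b \<in> {1..n+1} \<and> a \<noteq> b}"

definition perm_product :: "('a \<Rightarrow> 'a) list \<Rightarrow> 'a \<Rightarrow> 'a" where
  "perm_product ws = foldr (\<circ>) ws id"

definition refl_length :: "nat \<Rightarrow> (nat \<Rightarrow> nat) \<Rightarrow> nat" where
  "refl_length n w =
     (LEAST k. \<exists>ts. length ts = k \<and> set ts \<subseteq> reflections_A n \<and> perm_product ts = w)"

text \<open>The \<open>(n+1)\<close>-cycles.\<close>

definition coxeter_elements_A :: "nat \<Rightarrow> (nat \<Rightarrow> nat) set" where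
  "coxeter_elements_A n = {w \<in> W_A n. cyclic_on w {1..n+1}}"

text \<open>
  Cycles are the orbits on \<open>{1..n+1}\<close>; fixed points are the cycles of length 1.
\<close>

definition num_cycles :: "nat \<Rightarrow> (nat \<Rightarrow> nat) \<Rightarrow> nat \<Rightarrow> nat" where
  "num_cycles n w j = card {C \<in> orbit w ` {1..n+1}. card C = j}"

text \<open>
  A type \<open>A\<^sub>1\<^bsup>t 1\<^esup> * \<dots> * A\<^sub>n\<^bsup>t n\<^esup>\<close> is given by its exponents \<open>t 1, \<dots>, t n\<close>; the values of \<open>t\<close>
  outside \<open>{1..n}\<close> are irrelevant.
\<close>

definition has_type :: "nat \<Rightarrow> (nat \<Rightarrow> nat) \<Rightarrow> (nat \<Rightarrow> nat) \<Rightarrow> bool" where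
  "has_type n w t \<longleftrightarrow> w \<in> W_A n \<and> (\<forall>k\<in>{1..n}. num_cycles n w (k + 1) = t k)"

definition type_rank :: "nat \<Rightarrow> (nat \<Rightarrow> nat) \<Rightarrow> nat" where
  "type_rank n t = (\<Sum>k=1..n. k * t k)"

text \<open>
  The multinomial coefficient \<open>M! / (t 1! \<cdots> t r! (M - t 1 - \<dots> - t r)!)\<close>. As usual the
  reciprocal of the factorial of a negative integer is read as 0; the case distinction is needed
  because subtraction on \<^typ>\<open>nat\<close> truncates.
\<close>

definition multinomial :: "nat \<Rightarrow> nat \<Rightarrow> (nat \<Rightarrow> nat) \<Rightarrow> real" where
  "multinomial M r t =
     (if (\<Sum>k=1..r. t k) \<le> M
      then fact M / ((\<Prod>k=1..r. fact (t k)) * fact (M - (\<Sum>k=1..r. t k)))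
      else 0)"

text \<open>
  A factorisation is a pair consisting of the list of the first \<open>d\<close> factors and the list of the
  \<open>l\<close> blocks of the remaining factors; positions are counted from 0, so \<open>T i\<close>, \<open>m i\<close>, \<open>s i\<close> with
  index \<open>i\<close> stand for the data with index \<open>i + 1\<close> in one-based notation.
\<close>

definition factorisations ::
  "nat \<Rightarrow> (nat \<Rightarrow> nat) \<Rightarrow> nat \<Rightarrow> (nat \<Rightarrow> nat \<Rightarrow> nat) \<Rightarrow> nat \<Rightarrow> (nat \<Rightarrow> nat) \<Rightarrow> (nat \<Rightarrow> nat)
   \<Rightarrow> ((nat \<Rightarrow> nat) list \<times> (nat \<Rightarrow> nat) list list) set" where
  "factorisations n c d T l m s =
     {(ws, bs).
        length ws = d \<and> set ws \<subseteq> W_A n \<and>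
        length bs = l \<and> (\<forall>i<l. length (bs ! i) = m i \<and> set (bs ! i) \<subseteq> W_A n) \<and>
        c = perm_product (ws @ concat bs) \<and>
        (\<forall>i<d. has_type n (ws ! i) (T i)) \<and>
        (\<forall>i<l. sum_list (map (refl_length n) (bs ! i)) = s i)}"

end

theory Submission
  imports Defs
begin

text \<open>
  Write \<open>N\<close> for the number of points, \<open>cyc w\<close> for the number of cycles of \<open>w\<close> and \<open>W w\<close> for the
  product of its cycle lengths. Since ranks are subadditive, in a factorisation of a full cycle whose
  ranks add up to \<open>N - 1\<close> every partial product has the sum of the ranks of its factors as rank.

  First let \<open>w\<close> have \<open>r + 1\<close> cycles. The number of permutations \<open>\<sigma>\<close> of a given cycle type of rank \<open>r\<close>
  for which \<open>w \<circ> \<sigma>\<close> is a full cycle equals \<open>W w * r! / N\<close> times a constant \<open>D\<close> depending only on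
  the type. This goes by induction on \<open>N\<close>: a counting argument shows that \<open>w\<close> or \<open>\<sigma>\<close> has a fixed
  point, and deleting it amounts to splitting off a transposition from the other permutation.

  Next, a transposition step is uniform: the sum of \<open>W (w \<circ> \<tau>)\<close> over the transpositions \<open>\<tau>\<close> merging
  two cycles of \<open>w\<close> is \<open>W w * N * (cyc w - 1)\<close>. Commuting transpositions past \<open>\<sigma>\<close> turns the first
  count into the rule that, for every \<open>w\<close>, the sum of \<open>W (w \<circ> \<sigma>)\<close> over all \<open>\<sigma>\<close> of the given type whose
  rank adds to that of \<open>w\<close> is \<open>W w * D * (cyc w - 1)! / (cyc w - r - 1)!\<close>. The constants \<open>D\<close> multiply
  along products of such families and add along disjoint unions; summing over the types of rank \<open>r\<close>
  gives \<open>D = N choose r\<close>, and Vandermonde's identity treats the blocks. Starting from \<open>w = id\<close> one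
  counts the factorisations of all full cycles, and these are conjugate to each other.
\<close>

section \<open>Cycles of a permutation of a finite set\<close>

definition cycles_on :: "'a set \<Rightarrow> ('a \<Rightarrow> 'a) \<Rightarrow> 'a set set" where
  "cycles_on X p = orbit p ` X"

definition cyc :: "'a set \<Rightarrow> ('a \<Rightarrow> 'a) \<Rightarrow> nat" where
  "cyc X p = card (cycles_on X p)"

definition cycle_weight :: "'a set \<Rightarrow> ('a \<Rightarrow> 'a) \<Rightarrow> real" where
  "cycle_weight X p = (\<Prod>C\<in>cycles_on X p. real (card C))"

text \<open>Fixed points are kept as entries 1, so the entries add up to the number of
  points.\<close>

definition cycle_type :: "'a set \<Rightarrow> ('a \<Rightarrow> 'a) \<Rightarrow> nat multiset" where
  "cycle_type X p = image_mset card (mset_set (cycles_on X p))"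

text \<open>\<open>orbit p x\<close> starts with \<open>p x\<close>; it returns to \<open>x\<close>
  because a permutation of a finite set has finite order.\<close>

lemma permutes_self_in_orbit: "p permutes X \<Longrightarrow> finite X \<Longrightarrow> x \<in> orbit p x"
  by (meson permutation_permutes permutation_self_in_orbit)

lemma orbit_eq_iff:
  assumes "p permutes X" "finite X"
  shows "y \<in> orbit p x \<longleftrightarrow> orbit p y = orbit p x"
proof
  assume "y \<in> orbit p x"
  then show "orbit p y = orbit p x"
    by (metis assms cyclic_on_orbit orbit_cyclic_eq3)
next
  assume "orbit p y = orbit p x"
  then show "y \<in> orbit p x"
    using permutes_self_in_orbit[OF assms, of y] by simp
qed

lemma orbit_disjoint_or_eq:
  assumes "p permutes X" "finite X" "orbit p x \<noteq> orbit p y"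
  shows "orbit p x \<inter> orbit p y = {}"
  using assms by (metis disjoint_iff orbit_eq_iff)

lemma orbit_subset_invariant:
  assumes "x \<in> A" "\<And>y. y \<in> A \<Longrightarrow> p y \<in> A"
  shows "orbit p x \<subseteq> A"
proof
  fix y assume "y \<in> orbit p x"
  then show "y \<in> A" by induction (use assms in auto)
qed

lemma finite_cycles_on [simp]: "finite X \<Longrightarrow> finite (cycles_on X p)"
  by (simp add: cycles_on_def)

lemma cycles_on_facts:
  assumes "p permutes X" "finite X" "C \<in> cycles_on X p"
  shows "C \<subseteq> X" "C \<noteq> {}" "finite C" "card C > 0"
proof -
  obtain x where x: "x \<in> X" "C = orbit p x"
    using assms(3) by (auto simp: cycles_on_def)
  show "C \<subseteq> X" using permutes_orbit_subset[OF assms(1)] x by simp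
  show "C \<noteq> {}" using x orbit_nonempty by simp
  show "finite C" using \<open>C \<subseteq> X\<close> assms(2) finite_subset by auto
  then show "card C > 0" using \<open>C \<noteq> {}\<close> by (simp add: card_gt_0_iff)
qed

lemma card_orbit_pos:
  assumes "p permutes X" "finite X"
  shows "card (orbit p x) > 0"
  using assms permutes_self_in_orbit[OF assms, of x] finite_orbit[of x p]
  by (auto simp: card_gt_0_iff)

text \<open>Each cycle \<open>C\<close> is the orbit of exactly its \<open>card C\<close> points.
  With reciprocal lengths as \<open>f\<close>, the number of cycles appears.\<close>

lemma sum_over_cycles:
  fixes f :: "'a set \<Rightarrow> 'b::comm_semiring_1"
  assumes "p permutes X" "finite X"
  shows "(\<Sum>x\<in>X. f (orbit p x)) = (\<Sum>C\<in>cycles_on X p. of_nat (card C) * f C)"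
proof -
  have "(\<Sum>x\<in>X. f (orbit p x)) = (\<Sum>C\<in>orbit p ` X. \<Sum>x\<in>{x\<in>X. orbit p x = C}. f (orbit p x))"
    by (rule sum.image_gen) (use assms in simp)
  also have "\<dots> = (\<Sum>C\<in>orbit p ` X. of_nat (card C) * f C)"
  proof (rule sum.cong[OF refl])
    fix C assume C: "C \<in> orbit p ` X"
    then have "{x\<in>X. orbit p x = C} = C"
      using orbit_eq_iff[OF assms] permutes_orbit_subset[OF assms(1)] by (auto simp: subset_iff)
    moreover have "(\<Sum>x\<in>{x\<in>X. orbit p x = C}. f (orbit p x)) = (\<Sum>x\<in>{x\<in>X. orbit p x = C}. f C)"
      by (rule sum.cong) auto
    ultimately show "(\<Sum>x\<in>{x\<in>X. orbit p x = C}. f (orbit p x)) = of_nat (card C) * f C"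
      by simp
  qed
  finally show ?thesis by (simp add: cycles_on_def)
qed

lemma sum_card_cycles:
  assumes "p permutes X" "finite X"
  shows "(\<Sum>C\<in>cycles_on X p. card C) = card X"
  using sum_over_cycles[OF assms, of "\<lambda>_. 1::nat"] by simp

lemma sum_inverse_card_orbit:
  assumes "p permutes X" "finite X"
  shows "(\<Sum>x\<in>X. 1 / real (card (orbit p x))) = real (cyc X p)"
proof -
  have "(\<Sum>x\<in>X. 1 / real (card (orbit p x))) = (\<Sum>C\<in>cycles_on X p. real (card C) * (1 / real (card C)))"
    by (rule sum_over_cycles[OF assms])
  also have "\<dots> = (\<Sum>C\<in>cycles_on X p. 1)"
    using cycles_on_facts(4)[OF assms] by (intro sum.cong refl) auto
  finally show ?thesis by (simp add: cyc_def)
qed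

lemma cycle_type_basics:
  assumes "p permutes X" "finite X"
  shows "size (cycle_type X p) = cyc X p" "sum_mset (cycle_type X p) = card X"
    "0 \<notin># cycle_type X p"
proof -
  show "size (cycle_type X p) = cyc X p"
    by (simp add: cycle_type_def cyc_def)
  have "sum_mset (cycle_type X p) = (\<Sum>C\<in>cycles_on X p. card C)"
    by (simp add: cycle_type_def sum_unfold_sum_mset)
  then show "sum_mset (cycle_type X p) = card X"
    using sum_card_cycles[OF assms] by simp
  show "0 \<notin># cycle_type X p"
    using cycles_on_facts(4)[OF assms] assms(2) by (fastforce simp: cycle_type_def)
qed

lemma count_cycle_type:
  assumes "finite X"
  shows "count (cycle_type X p) k = card {C \<in> cycles_on X p. card C = k}"
proof -
  have "{C. k = card C \<and> C \<in> cycles_on X p} = {C \<in> cycles_on X p. card C = k}" by auto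
  then show ?thesis
    using assms by (simp add: cycle_type_def count_image_mset' vimage_def Int_def conj_commute)
qed

lemma cyc_pos:
  assumes "finite X" "X \<noteq> {}"
  shows "cyc X p > 0"
  using assms by (simp add: cyc_def card_gt_0_iff) (simp add: cycles_on_def)

lemma cyc_le_card: "finite X \<Longrightarrow> cyc X p \<le> card X"
  by (simp add: cyc_def cycles_on_def card_image_le)

lemma orbit_id: "orbit id x = {x}"
  by (simp add: orbit_eq_singleton_iff)

lemma cycles_on_id: "cycles_on X id = (\<lambda>x. {x}) ` X"
  by (simp add: cycles_on_def orbit_id)

lemma cyc_id: "cyc X id = card X"
  by (simp add: cyc_def cycles_on_id card_image)

lemma cycle_weight_id: "cycle_weight X id = 1"
  by (auto simp: cycle_weight_def cycles_on_id intro!: prod.neutral)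

lemma cyc_eq_1_iff:
  assumes "p permutes X" "finite X" "X \<noteq> {}"
  shows "cyc X p = 1 \<longleftrightarrow> cycles_on X p = {X}"
proof
  assume "cyc X p = 1"
  then obtain C where C: "cycles_on X p = {C}"
    by (auto simp: cyc_def card_1_singleton_iff)
  have "C = X"
  proof (rule antisym)
    show "C \<subseteq> X" using cycles_on_facts(1)[OF assms(1,2)] C by simp
    show "X \<subseteq> C"
      using C permutes_self_in_orbit[OF assms(1,2)] unfolding cycles_on_def by (metis image_eqI singletonD subsetI)
  qed
  then show "cycles_on X p = {X}" using C by simp
qed (simp add: cyc_def)

lemma cycle_weight_cyclic:
  assumes "p permutes X" "finite X" "X \<noteq> {}" "cyc X p = 1"
  shows "cycle_weight X p = card X"
  using cyc_eq_1_iff[OF assms(1-3)] assms(4) by (simp add: cycle_weight_def)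

section \<open>Multiplication by a transposition\<close>

text \<open>The new permutation sends \<open>a\<close> to \<open>p b\<close> and then follows
  \<open>p\<close> along the cycle of \<open>b\<close>, which does not meet
  \<open>a\<close>.\<close>

lemma orbit_subset_comp_transpose:
  assumes "a \<notin> orbit p b"
  shows "orbit p b \<subseteq> orbit (p \<circ> transpose a b) a"
proof
  fix y assume "y \<in> orbit p b"
  then show "y \<in> orbit (p \<circ> transpose a b) a"
  proof induction
    case base
    show ?case by (metis comp_apply orbit.base transpose_apply_first)
  next
    case (step y)
    show ?case
    proof (cases "y = b")
      case True
      then show ?thesis by (metis comp_apply orbit.base transpose_apply_first)
    next
      case False
      moreover have "y \<noteq> a" using step.hyps assms by auto
      ultimately show ?thesis
        using orbit.step[OF step.IH] by (simp add: transpose_apply_other)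
    qed
  qed
qed

text \<open>The two cycles are spliced into one: \<open>a\<close> is now followed by
  \<open>p b\<close>, and \<open>b\<close> by \<open>p a\<close>. All other cycles avoid both points
  and stay as they are.\<close>

lemma orbit_comp_transpose:
  assumes p: "p permutes X" and X: "finite X" and "a \<in> X" "b \<in> X" and ab: "a \<notin> orbit p b"
  shows "orbit (p \<circ> transpose a b) x =
    (if x \<in> orbit p a \<union> orbit p b then orbit p a \<union> orbit p b else orbit p x)"
proof -
  let ?q = "p \<circ> transpose a b"
  have q: "?q permutes X"
    by (rule permutes_compose[OF permutes_swap_id[OF \<open>a \<in> X\<close> \<open>b \<in> X\<close>] p])
  have ba: "b \<notin> orbit p a"
    using ab by (metis orbit_eq_iff[OF p X])
  have 1: "orbit p b \<subseteq> orbit ?q a" "orbit p a \<subseteq> orbit ?q b"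
    using orbit_subset_comp_transpose[OF ab] orbit_subset_comp_transpose[OF ba]
    by (simp_all add: transpose_commute)
  have "b \<in> orbit ?q a"
    using 1 permutes_self_in_orbit[OF p X] by auto
  then have eq: "orbit ?q b = orbit ?q a"
    by (simp add: orbit_eq_iff[OF q X])
  have "orbit ?q a \<subseteq> orbit p a \<union> orbit p b"
  proof (rule orbit_subset_invariant)
    show "a \<in> orbit p a \<union> orbit p b" using permutes_self_in_orbit[OF p X] by simp
    fix y assume "y \<in> orbit p a \<union> orbit p b"
    then show "?q y \<in> orbit p a \<union> orbit p b"
      by (cases "y = a"; cases "y = b") (auto simp: transpose_apply_other orbit.base orbit.step)
  qed
  then have m: "orbit ?q a = orbit p a \<union> orbit p b"
    using 1 eq by auto
  show ?thesis
  proof (cases "x \<in> orbit p a \<union> orbit p b")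
    case True
    then have "x \<in> orbit ?q a" using m by simp
    then have "orbit ?q x = orbit ?q a" by (simp add: orbit_eq_iff[OF q X])
    then show ?thesis using m True by simp
  next
    case False
    have "orbit ?q x = orbit p x"
    proof (rule orbit_cong[OF permutes_self_in_orbit[OF p X]])
      fix s assume "s \<in> orbit p x"
      then have "s \<noteq> a" "s \<noteq> b"
        using False by (metis UnI1 UnI2 orbit_eq_iff[OF p X])+
      then show "?q s = p s" by (simp add: transpose_apply_other)
    qed
    then show ?thesis using False by simp
  qed
qed

lemma cycles_on_comp_transpose:
  assumes p: "p permutes X" and X: "finite X" and "a \<in> X" "b \<in> X" and ab: "a \<notin> orbit p b"
  shows "cycles_on X (p \<circ> transpose a b) =
    insert (orbit p a \<union> orbit p b) (cycles_on X p - {orbit p a, orbit p b})"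
proof -
  let ?U = "orbit p a \<union> orbit p b"
  note eq = orbit_comp_transpose[OF assms]
  show ?thesis
  proof (intro set_eqI iffI)
    fix C assume "C \<in> cycles_on X (p \<circ> transpose a b)"
    then obtain x where "x \<in> X" "C = orbit (p \<circ> transpose a b) x"
      by (auto simp: cycles_on_def)
    then show "C \<in> insert ?U (cycles_on X p - {orbit p a, orbit p b})"
      using permutes_self_in_orbit[OF p X, of x] by (auto simp: eq cycles_on_def)
  next
    fix C assume "C \<in> insert ?U (cycles_on X p - {orbit p a, orbit p b})"
    then consider "C = ?U" | "C \<in> cycles_on X p" "C \<noteq> orbit p a" "C \<noteq> orbit p b" by auto
    then show "C \<in> cycles_on X (p \<circ> transpose a b)"
    proof cases
      case 1
      then have "C = orbit (p \<circ> transpose a b) a"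
        using permutes_self_in_orbit[OF p X, of a] by (simp add: eq)
      then show ?thesis using \<open>a \<in> X\<close> by (auto simp: cycles_on_def)
    next
      case 2
      then obtain x where "x \<in> X" "C = orbit p x" by (auto simp: cycles_on_def)
      then have "C = orbit (p \<circ> transpose a b) x"
        using 2 orbit_eq_iff[OF p X] by (auto simp: eq)
      then show ?thesis using \<open>x \<in> X\<close> by (auto simp: cycles_on_def)
    qed
  qed
qed

lemma merge_facts:
  assumes p: "p permutes X" and X: "finite X" and "a \<in> X" "b \<in> X" and ab: "a \<notin> orbit p b"
  shows "orbit p a \<noteq> orbit p b" "orbit p a \<in> cycles_on X p" "orbit p b \<in> cycles_on X p"
    "orbit p a \<union> orbit p b \<notin> cycles_on X p"
    "card (orbit p a \<union> orbit p b) = card (orbit p a) + card (orbit p b)"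
proof -
  show ne: "orbit p a \<noteq> orbit p b" using ab orbit_eq_iff[OF p X] by auto
  show "orbit p a \<in> cycles_on X p" "orbit p b \<in> cycles_on X p"
    using assms by (auto simp: cycles_on_def)
  show "orbit p a \<union> orbit p b \<notin> cycles_on X p"
  proof
    assume "orbit p a \<union> orbit p b \<in> cycles_on X p"
    then obtain x where x: "orbit p a \<union> orbit p b = orbit p x" by (auto simp: cycles_on_def)
    have "a \<in> orbit p x" "b \<in> orbit p x"
      using permutes_self_in_orbit[OF p X] x by blast+
    then show False using ne by (simp add: orbit_eq_iff[OF p X])
  qed
  show "card (orbit p a \<union> orbit p b) = card (orbit p a) + card (orbit p b)"
    using orbit_disjoint_or_eq[OF p X ne] permutes_self_in_orbit[OF p X]
    by (intro card_Un_disjoint finite_orbit) auto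
qed

lemma cyc_merge:
  assumes p: "p permutes X" and X: "finite X" and "a \<in> X" "b \<in> X" and ab: "a \<notin> orbit p b"
  shows "Suc (cyc X (p \<circ> transpose a b)) = cyc X p"
proof -
  note mf = merge_facts[OF assms]
  have "card {orbit p a, orbit p b} \<le> card (cycles_on X p)"
    using mf X by (intro card_mono) auto
  then show ?thesis
    unfolding cyc_def cycles_on_comp_transpose[OF assms]
    using mf X by (subst card_insert_disjoint) (auto simp: card_Diff_subset)
qed

text \<open>In the product of the lengths two factors are replaced by their sum; multiplying by them
  keeps the identity free of division.\<close>

lemma cycle_weight_merge:
  assumes p: "p permutes X" and X: "finite X" and "a \<in> X" "b \<in> X" and ab: "a \<notin> orbit p b"
  shows "cycle_weight X (p \<circ> transpose a b) * (real (card (orbit p a)) * real (card (orbit p b))) =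
    cycle_weight X p * (real (card (orbit p a)) + real (card (orbit p b)))"
proof -
  note mf = merge_facts[OF assms]
  have "cycle_weight X p = (\<Prod>C\<in>cycles_on X p - {orbit p a, orbit p b}. real (card C)) *
      (\<Prod>C\<in>{orbit p a, orbit p b}. real (card C))"
    unfolding cycle_weight_def using mf X by (intro prod.subset_diff) auto
  moreover have "cycle_weight X (p \<circ> transpose a b) =
      real (card (orbit p a \<union> orbit p b)) * (\<Prod>C\<in>cycles_on X p - {orbit p a, orbit p b}. real (card C))"
    unfolding cycle_weight_def cycles_on_comp_transpose[OF assms]
    using mf X by (subst prod.insert) auto
  ultimately show ?thesis using mf by simp
qed

text \<open>The two vanishing lengths are added on the left instead of being subtracted on the
  right, since subtraction of multisets truncates.\<close>

lemma cycle_type_merge: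
  assumes p: "p permutes X" and X: "finite X" and "a \<in> X" "b \<in> X" and ab: "a \<notin> orbit p b"
  shows "cycle_type X (p \<circ> transpose a b) + {#card (orbit p a), card (orbit p b)#} =
    cycle_type X p + {#card (orbit p a) + card (orbit p b)#}"
proof -
  note mf = merge_facts[OF assms]
  have "mset_set (cycles_on X p) =
    mset_set (cycles_on X p - {orbit p a, orbit p b}) + mset_set {orbit p a, orbit p b}"
  proof -
    have "cycles_on X p = (cycles_on X p - {orbit p a, orbit p b}) \<union> {orbit p a, orbit p b}"
      using mf by auto
    then show ?thesis
      using X mset_set_Union[of "cycles_on X p - {orbit p a, orbit p b}" "{orbit p a, orbit p b}"] by auto
  qed
  moreover have "mset_set (cycles_on X (p \<circ> transpose a b)) =
    add_mset (orbit p a \<union> orbit p b) (mset_set (cycles_on X p - {orbit p a, orbit p b}))"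
    unfolding cycles_on_comp_transpose[OF assms]
    using mf X by (intro mset_set.insert) auto
  ultimately show ?thesis using mf by (simp add: cycle_type_def)
qed

text \<open>Every cycle of the new permutation lies inside a cycle of \<open>p\<close>; sending it
  to that cycle, as the union of the \<open>p\<close>-orbits of its points, is a surjection onto the
  cycles of \<open>p\<close>.\<close>

lemma cyc_comp_transpose_same_orbit:
  assumes p: "p permutes X" and X: "finite X" and "a \<in> X" "b \<in> X" and ab: "a \<in> orbit p b"
  shows "cyc X p \<le> cyc X (p \<circ> transpose a b)"
proof -
  let ?q = "p \<circ> transpose a b"
  have q: "?q permutes X"
    by (rule permutes_compose[OF permutes_swap_id[OF \<open>a \<in> X\<close> \<open>b \<in> X\<close>] p])
  have sub: "orbit ?q x \<subseteq> orbit p x" for x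
  proof (rule orbit_subset_invariant)
    show "x \<in> orbit p x" by (rule permutes_self_in_orbit[OF p X])
    fix y assume y: "y \<in> orbit p x"
    have "orbit p a = orbit p b" using ab orbit_eq_iff[OF p X] by simp
    then have "transpose a b y \<in> orbit p x"
      using y orbit_eq_iff[OF p X] by (cases "y = a"; cases "y = b") (auto simp: transpose_apply_other)
    then show "?q y \<in> orbit p x" by (simp add: orbit.step)
  qed
  have "cycles_on X p \<subseteq> (\<lambda>C. \<Union>x\<in>C. orbit p x) ` cycles_on X ?q"
  proof
    fix C assume "C \<in> cycles_on X p"
    then obtain x where x: "x \<in> X" "C = orbit p x" by (auto simp: cycles_on_def)
    have "C = (\<Union>y\<in>orbit ?q x. orbit p y)"
    proof
      show "C \<subseteq> (\<Union>y\<in>orbit ?q x. orbit p y)"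
        using permutes_self_in_orbit[OF q X, of x] x(2) by auto
      have "orbit p y = C" if "y \<in> orbit ?q x" for y
        using sub that orbit_eq_iff[OF p X] x(2) by blast
      then show "(\<Union>y\<in>orbit ?q x. orbit p y) \<subseteq> C" by simp
    qed
    then show "C \<in> (\<lambda>C. \<Union>x\<in>C. orbit p x) ` cycles_on X ?q"
      using x(1) by (auto simp: cycles_on_def)
  qed
  then show ?thesis
    unfolding cyc_def by (rule surj_card_le[rotated]) (use X in simp)
qed

lemma Suc_cyc_comp_transpose_iff:
  assumes p: "p permutes X" and X: "finite X" and "a \<in> X" "b \<in> X"
  shows "Suc (cyc X (p \<circ> transpose a b)) = cyc X p \<longleftrightarrow> a \<notin> orbit p b"
  using cyc_merge[OF assms] cyc_comp_transpose_same_orbit[OF assms] by force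

lemma cyc_le_Suc_comp_transpose:
  assumes p: "p permutes X" and X: "finite X" and "a \<in> X" "b \<in> X"
  shows "cyc X p \<le> Suc (cyc X (p \<circ> transpose a b))"
  using cyc_merge[OF assms] cyc_comp_transpose_same_orbit[OF assms] by force

text \<open>The pairs are ordered, so each transposition counts twice. Joining cycles of lengths
  \<open>x\<close> and \<open>y\<close> multiplies the weight by \<open>1/x + 1/y\<close>. For fixed
  \<open>a\<close> on a cycle of length \<open>x\<close>, the term \<open>1/x\<close> summed over
  the points off this cycle gives \<open>N/x - 1\<close>, and \<open>1/x\<close> summed over all
  points is the number of cycles.\<close>

lemma sum_transpose_merge:
  assumes u: "u permutes X" and X: "finite X"
  shows "(\<Sum>(a, b) | (a, b) \<in> X \<times> X \<and> Suc (cyc X (u \<circ> transpose a b)) = cyc X u.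
            cycle_weight X (u \<circ> transpose a b)) =
         2 * cycle_weight X u * card X * (real (cyc X u) - 1)"
proof -
  let ?n = "\<lambda>x. real (card (orbit u x))" and ?W = "cycle_weight X u"
  have n0: "?n x > 0" for x using card_orbit_pos[OF u X] by simp
  have "(\<Sum>(a, b) | (a, b) \<in> X \<times> X \<and> Suc (cyc X (u \<circ> transpose a b)) = cyc X u.
            cycle_weight X (u \<circ> transpose a b)) =
        (\<Sum>(a, b) | (a, b) \<in> X \<times> X \<and> a \<notin> orbit u b. ?W * (1 / ?n a + 1 / ?n b))"
  proof (rule sum.cong)
    show "{(a, b). (a, b) \<in> X \<times> X \<and> Suc (cyc X (u \<circ> transpose a b)) = cyc X u} =
      {(a, b). (a, b) \<in> X \<times> X \<and> a \<notin> orbit u b}"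
      using Suc_cyc_comp_transpose_iff[OF u X] by auto
    fix ab assume "ab \<in> {(a, b). (a, b) \<in> X \<times> X \<and> a \<notin> orbit u b}"
    then obtain a b where ab: "ab = (a, b)" "a \<in> X" "b \<in> X" "a \<notin> orbit u b" by auto
    have "cycle_weight X (u \<circ> transpose a b) = ?W * (1 / ?n a + 1 / ?n b)"
      using cycle_weight_merge[OF u X ab(2-4)] n0[of a] n0[of b] by (simp add: field_simps)
    then show "(case ab of (a, b) \<Rightarrow> cycle_weight X (u \<circ> transpose a b)) =
      (case ab of (a, b) \<Rightarrow> ?W * (1 / ?n a + 1 / ?n b))" using ab by simp
  qed
  also have "\<dots> = (\<Sum>(a, b)\<in>X \<times> X. if a \<notin> orbit u b then ?W * (1 / ?n a + 1 / ?n b) else 0)"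
    by (rule sum.mono_neutral_cong_left) (use X in auto)
  also have "\<dots> = (\<Sum>a\<in>X. \<Sum>b\<in>X. if a \<notin> orbit u b then ?W / ?n a else 0) +
      (\<Sum>a\<in>X. \<Sum>b\<in>X. if a \<notin> orbit u b then ?W / ?n b else 0)"
    unfolding sum.cartesian_product[symmetric] sum.distrib[symmetric]
    by (intro sum.cong refl) (simp add: algebra_simps)
  \<comment> \<open>By symmetry in the two points the second half equals the first.\<close>
  also have "(\<Sum>a\<in>X. \<Sum>b\<in>X. if a \<notin> orbit u b then ?W / ?n b else 0) =
      (\<Sum>b\<in>X. \<Sum>a\<in>X. if b \<notin> orbit u a then ?W / ?n b else 0)"
    by (subst sum.swap) (intro sum.cong refl, use orbit_eq_iff[OF u X] in auto)
  also have "(\<Sum>a\<in>X. \<Sum>b\<in>X. if a \<notin> orbit u b then ?W / ?n a else 0) +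
      (\<Sum>a\<in>X. \<Sum>b\<in>X. if a \<notin> orbit u b then ?W / ?n a else 0) =
      2 * (\<Sum>a\<in>X. \<Sum>b\<in>X. if a \<notin> orbit u b then ?W / ?n a else 0)" by simp
  also have "(\<Sum>a\<in>X. \<Sum>b\<in>X. if a \<notin> orbit u b then ?W / ?n a else 0) =
     (\<Sum>a\<in>X. ?W * (real (card X) * (1 / ?n a) - 1))"
  proof (rule sum.cong[OF refl])
    fix a assume a: "a \<in> X"
    have "(\<Sum>b\<in>X. if a \<notin> orbit u b then ?W / ?n a else 0) = (\<Sum>b\<in>X - orbit u a. ?W / ?n a)"
      using X orbit_eq_iff[OF u X] by (intro sum.mono_neutral_cong_right) auto
    also have "\<dots> = (real (card X) - ?n a) * (?W / ?n a)"
      using permutes_orbit_subset[OF u a] X card_mono[OF X permutes_orbit_subset[OF u a]]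
      by (simp add: card_Diff_subset finite_subset of_nat_diff)
    also have "\<dots> = ?W * (real (card X) * (1 / ?n a) - 1)"
      using n0[of a] by (simp add: field_simps)
    finally show "(\<Sum>b\<in>X. if a \<notin> orbit u b then ?W / ?n a else 0) = ?W * (real (card X) * (1 / ?n a) - 1)" .
  qed
  also have "\<dots> = ?W * (real (card X) * (\<Sum>a\<in>X. 1 / ?n a) - card X)"
    by (simp add: sum_distrib_left sum_subtractf right_diff_distrib)
  also have "(\<Sum>a\<in>X. 1 / ?n a) = real (cyc X u)"
    by (rule sum_inverse_card_orbit[OF u X])
  also have "2 * (?W * (real (card X) * real (cyc X u) - real (card X))) =
    2 * ?W * card X * (real (cyc X u) - 1)" by (simp add: algebra_simps)
  finally show ?thesis .
qed

section \<open>Removing a point\<close>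

lemma permutes_remove_fixpoint:
  "\<sigma> permutes X \<and> \<sigma> a = a \<longleftrightarrow> \<sigma> permutes (X - {a})" if "a \<in> X"
proof
  assume "\<sigma> permutes (X - {a})"
  then show "\<sigma> permutes X \<and> \<sigma> a = a"
    using permutes_not_in[of \<sigma> "X - {a}" a] permutes_subset[of \<sigma> "X - {a}" X] by auto
next
  assume *: "\<sigma> permutes X \<and> \<sigma> a = a"
  show "\<sigma> permutes (X - {a})"
    by (rule permutes_superset[of _ X]) (use * in auto)
qed

lemma cycles_on_fixpoint:
  assumes "a \<in> X" "finite X" "\<sigma> permutes (X - {a})"
  shows "cycles_on X \<sigma> = insert {a} (cycles_on (X - {a}) \<sigma>)" "{a} \<notin> cycles_on (X - {a}) \<sigma>"
proof -
  have "orbit \<sigma> a = {a}"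
    using permutes_not_in[OF assms(3)] by (simp add: orbit_eq_singleton_iff)
  then show "cycles_on X \<sigma> = insert {a} (cycles_on (X - {a}) \<sigma>)"
    using assms(1) by (auto simp: cycles_on_def)
  show "{a} \<notin> cycles_on (X - {a}) \<sigma>"
    using cycles_on_facts(1)[OF assms(3), of "{a}"] assms(2) by auto
qed

lemma fixpoint_facts:
  assumes "a \<in> X" "finite X" "\<sigma> permutes (X - {a})"
  shows "cyc X \<sigma> = Suc (cyc (X - {a}) \<sigma>)"
    "cycle_weight X \<sigma> = cycle_weight (X - {a}) \<sigma>"
    "cycle_type X \<sigma> = add_mset 1 (cycle_type (X - {a}) \<sigma>)"
  using cycles_on_fixpoint[OF assms] assms(2)
  by (simp_all add: cyc_def cycle_weight_def cycle_type_def)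

text \<open>As \<open>\<sigma>\<close> fixes \<open>a\<close>, the singleton cycle of
  \<open>a\<close> is merged into the cycle of \<open>b\<close>: the point \<open>a\<close> is
  inserted right after \<open>b\<close>.\<close>

lemma insert_point_facts:
  assumes "a \<in> X" "finite X" and \<sigma>: "\<sigma> permutes (X - {a})" and b: "b \<in> X - {a}"
  shows "\<sigma> \<circ> transpose a b permutes X"
    "cyc X (\<sigma> \<circ> transpose a b) = cyc (X - {a}) \<sigma>"
    "cycle_weight X (\<sigma> \<circ> transpose a b) * card (orbit \<sigma> b) =
      cycle_weight (X - {a}) \<sigma> * (card (orbit \<sigma> b) + 1)"
    "cycle_type X (\<sigma> \<circ> transpose a b) + {#card (orbit \<sigma> b)#} =
      cycle_type (X - {a}) \<sigma> + {#Suc (card (orbit \<sigma> b))#}"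
    "card (orbit (\<sigma> \<circ> transpose a b) a) = Suc (card (orbit \<sigma> b))"
proof -
  have oa: "orbit \<sigma> a = {a}"
    using permutes_not_in[OF \<sigma>] by (simp add: orbit_eq_singleton_iff)
  have ab: "a \<notin> orbit \<sigma> b"
    using permutes_orbit_subset[OF \<sigma> b] by auto
  have p: "\<sigma> permutes X"
    using permutes_remove_fixpoint[OF assms(1)] \<sigma> by blast
  have bX: "b \<in> X" using b by simp
  show "\<sigma> \<circ> transpose a b permutes X"
    by (rule permutes_compose[OF permutes_swap_id[OF \<open>a \<in> X\<close> bX] p])
  note f = fixpoint_facts[OF assms(1-2) \<sigma>]
  show "cyc X (\<sigma> \<circ> transpose a b) = cyc (X - {a}) \<sigma>"
    using cyc_merge[OF p assms(2,1) bX ab] f(1) by simp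
  show "cycle_weight X (\<sigma> \<circ> transpose a b) * card (orbit \<sigma> b) =
      cycle_weight (X - {a}) \<sigma> * (card (orbit \<sigma> b) + 1)"
    using cycle_weight_merge[OF p assms(2,1) bX ab] oa f(2) by simp
  show "cycle_type X (\<sigma> \<circ> transpose a b) + {#card (orbit \<sigma> b)#} =
      cycle_type (X - {a}) \<sigma> + {#Suc (card (orbit \<sigma> b))#}"
    using cycle_type_merge[OF p assms(2,1) bX ab] oa f(3) by simp
  have "finite (orbit \<sigma> b)"
    using permutes_orbit_subset[OF \<sigma> b] assms(2) finite_subset by blast
  then show "card (orbit (\<sigma> \<circ> transpose a b) a) = Suc (card (orbit \<sigma> b))"
    using orbit_comp_transpose[OF p assms(2,1) bX ab, of a] oa ab by simp
qed

text \<open>A permutation moving \<open>a\<close> arises in exactly one way by inserting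
  \<open>a\<close>, namely after its predecessor \<open>inv \<sigma> a\<close>.\<close>

lemma bij_betw_insert_point:
  assumes "a \<in> X"
  shows "bij_betw (\<lambda>(\<sigma>, b). \<sigma> \<circ> transpose a b)
    ({\<sigma>. \<sigma> permutes (X - {a})} \<times> (X - {a})) {\<sigma>. \<sigma> permutes X \<and> \<sigma> a \<noteq> a}"
proof (rule bij_betw_byWitness[where f' = "\<lambda>\<sigma>. (\<sigma> \<circ> transpose a (inv \<sigma> a), inv \<sigma> a)"])
  show "\<forall>x\<in>{\<sigma>. \<sigma> permutes (X - {a})} \<times> (X - {a}).
    (\<lambda>\<sigma>. (\<sigma> \<circ> transpose a (inv \<sigma> a), inv \<sigma> a)) (case x of (\<sigma>, b) \<Rightarrow> \<sigma> \<circ> transpose a b) = x"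
  proof
    fix x assume "x \<in> {\<sigma>. \<sigma> permutes (X - {a})} \<times> (X - {a})"
    then obtain \<sigma> b where x: "x = (\<sigma>, b)" and s: "\<sigma> permutes (X - {a})" and b: "b \<in> X" "b \<noteq> a"
      by auto
    let ?p = "\<sigma> \<circ> transpose a b"
    have "\<sigma> permutes X" using s permutes_remove_fixpoint[OF assms] by blast
    then have p: "?p permutes X"
      by (rule permutes_compose[OF permutes_swap_id[OF assms b(1)]])
    have "?p b = a"
      using permutes_not_in[OF s, of a] by simp
    then have i: "inv ?p a = b"
      using permutes_inv_eq[OF p] by blast
    show "(\<lambda>\<sigma>. (\<sigma> \<circ> transpose a (inv \<sigma> a), inv \<sigma> a)) (case x of (\<sigma>, b) \<Rightarrow> \<sigma> \<circ> transpose a b) = x"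
      unfolding x prod.case i by (simp add: comp_assoc)
  qed
  show "\<forall>\<sigma>\<in>{\<sigma>. \<sigma> permutes X \<and> \<sigma> a \<noteq> a}.
    (case (\<sigma> \<circ> transpose a (inv \<sigma> a), inv \<sigma> a) of (\<sigma>, b) \<Rightarrow> \<sigma> \<circ> transpose a b) = \<sigma>"
    by (simp add: comp_assoc)
  show "(\<lambda>(\<sigma>, b). \<sigma> \<circ> transpose a b) ` ({\<sigma>. \<sigma> permutes (X - {a})} \<times> (X - {a}))
    \<subseteq> {\<sigma>. \<sigma> permutes X \<and> \<sigma> a \<noteq> a}"
  proof safe
    fix \<sigma> b assume s: "\<sigma> permutes (X - {a})" and b: "b \<in> X" "b \<noteq> a"
    have "\<sigma> permutes X" using s permutes_remove_fixpoint[OF assms] by blast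
    then show "\<sigma> \<circ> transpose a b permutes X"
      by (rule permutes_compose[OF permutes_swap_id[OF assms b(1)]])
    have "\<sigma> b \<in> X - {a}" using b permutes_in_image[OF s] by simp
    then show "(\<sigma> \<circ> transpose a b) a = a \<Longrightarrow> False" by simp
  qed
  show "(\<lambda>\<sigma>. (\<sigma> \<circ> transpose a (inv \<sigma> a), inv \<sigma> a)) ` {\<sigma>. \<sigma> permutes X \<and> \<sigma> a \<noteq> a}
    \<subseteq> {\<sigma>. \<sigma> permutes (X - {a})} \<times> (X - {a})"
  proof (rule image_subsetI)
    fix \<sigma> assume "\<sigma> \<in> {\<sigma>. \<sigma> permutes X \<and> \<sigma> a \<noteq> a}"
    then have s: "\<sigma> permutes X" "\<sigma> a \<noteq> a" by auto
    have iX: "inv \<sigma> a \<in> X" using permutes_in_image[OF permutes_inv[OF s(1)]] assms by simp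
    have "\<sigma> \<circ> transpose a (inv \<sigma> a) permutes X"
      by (rule permutes_compose[OF permutes_swap_id[OF assms iX] s(1)])
    moreover have "(\<sigma> \<circ> transpose a (inv \<sigma> a)) a = a"
      using permutes_inverses(1)[OF s(1)] by simp
    ultimately have "\<sigma> \<circ> transpose a (inv \<sigma> a) permutes (X - {a})"
      using permutes_remove_fixpoint[OF assms] by blast
    moreover have "inv \<sigma> a \<noteq> a" using s permutes_inv_eq[OF s(1)] by auto
    ultimately show "(\<sigma> \<circ> transpose a (inv \<sigma> a), inv \<sigma> a) \<in> {\<sigma>. \<sigma> permutes (X - {a})} \<times> (X - {a})"
      using iX by simp
  qed
qed

lemma card_points_in_cycles:
  assumes "\<sigma> permutes X" "finite X"
  shows "card {x \<in> X. card (orbit \<sigma> x) = k} = k * count (cycle_type X \<sigma>) k"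
proof -
  have "card {x \<in> X. card (orbit \<sigma> x) = k} = (\<Sum>x\<in>X. if card (orbit \<sigma> x) = k then 1 else 0)"
    by (simp add: sum.inter_filter[OF assms(2), symmetric])
  also have "\<dots> = (\<Sum>C\<in>cycles_on X \<sigma>. card C * (if card C = k then 1 else 0))"
    using sum_over_cycles[OF assms, of "\<lambda>C. if card C = k then 1 else 0 :: nat"] by simp
  also have "\<dots> = (\<Sum>C\<in>{C \<in> cycles_on X \<sigma>. card C = k}. k)"
    using assms(2) by (intro sum.mono_neutral_cong_right) auto
  finally show ?thesis by (simp add: count_cycle_type[OF assms(2)])
qed

lemma card_fixpoints:
  assumes "\<sigma> permutes X" "finite X"
  shows "card {x \<in> X. \<sigma> x = x} = count (cycle_type X \<sigma>) 1"
proof -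
  have "{x \<in> X. \<sigma> x = x} = {x \<in> X. card (orbit \<sigma> x) = 1}"
  proof -
    have "\<sigma> x = x \<longleftrightarrow> card (orbit \<sigma> x) = 1" for x
      using permutes_self_in_orbit[OF assms, of x]
      by (metis card_1_singletonE is_singletonI is_singleton_altdef orbit_eq_singleton_iff singletonD)
    then show ?thesis by simp
  qed
  then show ?thesis using card_points_in_cycles[OF assms, of 1] by simp
qed

section \<open>Completing a permutation to a full cycle\<close>

lemma sum_count_pred:
  fixes M :: "nat multiset"
  shows "(\<Sum>j\<in>set_mset M. (real j - 1) * real (count M j)) = real (sum_mset M) - real (size M)"
proof -
  \<comment> \<open>The support of \<open>M\<close> changes during the induction, so the sum runs
    over a fixed finite set containing it.\<close>
  have "(\<Sum>j\<in>A. (real j - 1) * real (count M j)) = real (sum_mset M) - real (size M)"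
    if "finite A" "set_mset M \<subseteq> A" for A
    using that(2)
  proof (induction M)
    case (add x M)
    have "(\<Sum>j\<in>A. (real j - 1) * real (count (add_mset x M) j)) =
        (\<Sum>j\<in>A. (real j - 1) * real (count M j) + (if j = x then real x - 1 else 0))"
      by (intro sum.cong) (auto simp: algebra_simps)
    also have "\<dots> = (\<Sum>j\<in>A. (real j - 1) * real (count M j)) + (real x - 1)"
      using add.prems that(1) by (simp add: sum.distrib)
    finally show ?case using add by simp
  qed simp
  then show ?thesis by simp
qed

text \<open>Marking one entry of an arrangement and deleting it shows that both sides equal the size
  times the number of arrangements of the common remainder \<open>M - {#j#}\<close>.\<close>

lemma permutations_of_multiset_shift:
  assumes "j \<in># M" "Q = add_mset i (M - {#j#})"
  shows "card (permutations_of_multiset Q) * count Q i = card (permutations_of_multiset M) * count M j"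
proof -
  obtain R where R: "M = add_mset j R" using assms(1) by (metis multi_member_split)
  have "i \<in># Q" "Q - {#i#} = M - {#j#}" "size Q = size M"
    using assms(2) unfolding R by auto
  then show ?thesis
    using card_permutations_of_multiset_remove_aux[of i Q]
      card_permutations_of_multiset_remove_aux[OF assms(1)] by simp
qed

definition cyclic_completions :: "'a set \<Rightarrow> ('a \<Rightarrow> 'a) \<Rightarrow> nat multiset \<Rightarrow> ('a \<Rightarrow> 'a) set" where
  "cyclic_completions X w M = {\<sigma>. \<sigma> permutes X \<and> cycle_type X \<sigma> = M \<and> cyc X (w \<circ> \<sigma>) = 1}"

lemma finite_cyclic_completions: "finite X \<Longrightarrow> finite (cyclic_completions X w M)"
  unfolding cyclic_completions_def by (rule finite_subset[OF _ finite_permutations[of X]]) auto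

text \<open>If \<open>\<sigma>\<close> fixed \<open>c\<close> as \<open>w\<close> does,
  \<open>{c}\<close> would be a cycle of \<open>w \<circ> \<sigma>\<close> next to at least one
  cycle on the remaining points.\<close>

lemma cyclic_completions_not_fix:
  assumes X: "finite X" and c: "c \<in> X" and Y: "X - {c} \<noteq> {}" and w: "w permutes (X - {c})"
    and \<sigma>: "\<sigma> \<in> cyclic_completions X w M"
  shows "\<sigma> c \<noteq> c"
proof
  assume "\<sigma> c = c"
  then have "\<sigma> permutes (X - {c})"
    using \<sigma> permutes_remove_fixpoint[OF c] unfolding cyclic_completions_def by blast
  then have "cyc X (w \<circ> \<sigma>) = Suc (cyc (X - {c}) (w \<circ> \<sigma>))"
    by (intro fixpoint_facts[OF c X] permutes_compose w)
  moreover have "cyc (X - {c}) (w \<circ> \<sigma>) > 0" using X Y by (intro cyc_pos) auto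
  ultimately show False
    using \<sigma> unfolding cyclic_completions_def by simp
qed

text \<open>Insertion lengthens one cycle from \<open>k\<close> to \<open>k + 1\<close>; undoing
  this on multisets presupposes that \<open>Suc k\<close> occurs in \<open>M\<close>.\<close>

lemma cycle_type_insert_point_iff:
  assumes "a \<in> X" "finite X" "\<sigma> permutes (X - {a})" "b \<in> X - {a}"
  defines "k \<equiv> card (orbit \<sigma> b)"
  shows "cycle_type X (\<sigma> \<circ> transpose a b) = M \<longleftrightarrow>
    Suc k \<in># M \<and> cycle_type (X - {a}) \<sigma> = add_mset k (M - {#Suc k#})" (is "?L \<longleftrightarrow> ?R")
proof
  note ins = insert_point_facts(4)[OF assms(1-4), folded k_def]
  assume ?L
  then have e: "M + {#k#} = cycle_type (X - {a}) \<sigma> + {#Suc k#}" using ins by simp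
  then have "Suc k \<in># M + {#k#}" by simp
  then have "Suc k \<in># M" by simp
  then obtain M' where "M = add_mset (Suc k) M'" by (metis multi_member_split)
  then show ?R using e by simp
next
  note ins = insert_point_facts(4)[OF assms(1-4), folded k_def]
  assume ?R
  moreover from this obtain M' where "M = add_mset (Suc k) M'" by (metis multi_member_split)
  ultimately show ?L using ins by simp
qed

text \<open>Since \<open>w\<close> fixes \<open>c\<close>, a completion must move it, and deleting
  \<open>c\<close> shortens its cycle from some length \<open>j\<close> to \<open>j - 1\<close>.
  Conversely, \<open>c\<close> can be inserted after any point on a cycle of length
  \<open>j - 1\<close>; the number of these points is \<open>j - 1\<close> times the number of such
  cycles.\<close>

lemma card_cyclic_completions_fixpoint:
  assumes X: "finite X" and c: "c \<in> X" and Y: "X - {c} \<noteq> {}" and w: "w permutes (X - {c})"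
    and M: "0 \<notin># M"
  shows "card (cyclic_completions X w M) =
    (\<Sum>j\<in>set_mset M - {1}. (j - 1) * count (add_mset (j - 1) (M - {#j#})) (j - 1) *
      card (cyclic_completions (X - {c}) w (add_mset (j - 1) (M - {#j#}))))"
proof -
  let ?Y = "X - {c}" and ?M = "\<lambda>j. add_mset (j - 1) (M - {#j#})"
  let ?f = "\<lambda>(\<sigma>, b). \<sigma> \<circ> transpose c b"
  let ?P = "\<lambda>j. SIGMA \<sigma>:cyclic_completions ?Y w (?M j). {b \<in> ?Y. card (orbit \<sigma> b) = j - 1}"
  let ?S = "{(\<sigma>, b). \<sigma> permutes ?Y \<and> b \<in> ?Y \<and> \<sigma> \<circ> transpose c b \<in> cyclic_completions X w M}"
  note bij = bij_betw_insert_point[OF c]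
  have "?f ` ?S = cyclic_completions X w M"
  proof (intro set_eqI iffI)
    fix \<sigma> assume \<sigma>: "\<sigma> \<in> cyclic_completions X w M"
    then have "\<sigma> \<in> {\<sigma>. \<sigma> permutes X \<and> \<sigma> c \<noteq> c}"
      using cyclic_completions_not_fix[OF X c Y w \<sigma>] by (simp add: cyclic_completions_def)
    then obtain x where "x \<in> {\<sigma>. \<sigma> permutes ?Y} \<times> ?Y" "?f x = \<sigma>"
      using bij unfolding bij_betw_def by (metis (no_types, lifting) imageE)
    then show "\<sigma> \<in> ?f ` ?S" using \<sigma> by (intro image_eqI[of _ _ x]) auto
  qed (auto simp only: image_iff mem_Collect_eq prod.case)
  moreover have "inj_on ?f ?S"
    by (rule inj_on_subset[OF bij_betw_imp_inj_on[OF bij]]) auto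
  ultimately have "card (cyclic_completions X w M) = card ?S"
    using card_image[of ?f ?S] by (simp only:)
  also have "?S = (\<Union>j\<in>set_mset M - {1}. ?P j)"
  proof -
    have "(\<sigma>, b) \<in> ?S \<longleftrightarrow> (\<sigma>, b) \<in> (\<Union>j\<in>set_mset M - {1}. ?P j)" for \<sigma> b
    proof (cases "\<sigma> permutes ?Y \<and> b \<in> ?Y")
      case True
      then have \<sigma>: "\<sigma> permutes ?Y" and b: "b \<in> ?Y" by auto
      note ins = insert_point_facts[OF c X \<sigma> b]
      \<comment> \<open>The same insertion takes place in the product
        \<open>w \<circ> \<sigma>\<close>, so its number of cycles on the smaller set is that of the
        new product on \<open>X\<close>.\<close>
      note ins2 = insert_point_facts[OF c X permutes_compose[OF \<sigma> w] b]
      let ?k = "card (orbit \<sigma> b)"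
      have k: "?k > 0" using card_orbit_pos[OF \<sigma>] X by simp
      have "(\<sigma>, b) \<in> ?S \<longleftrightarrow> cycle_type X (\<sigma> \<circ> transpose c b) = M \<and> cyc ?Y (w \<circ> \<sigma>) = 1"
        using True ins ins2 by (simp add: cyclic_completions_def comp_assoc)
      also have "cycle_type X (\<sigma> \<circ> transpose c b) = M \<longleftrightarrow>
          Suc ?k \<in># M \<and> cycle_type ?Y \<sigma> = add_mset ?k (M - {#Suc ?k#})"
        by (rule cycle_type_insert_point_iff[OF c X \<sigma> b])
      also have "(\<dots> \<and> cyc ?Y (w \<circ> \<sigma>) = 1) \<longleftrightarrow> (\<sigma>, b) \<in> ?P (Suc ?k) \<and> Suc ?k \<in># M"
        using True by (auto simp: cyclic_completions_def)
      also have "\<dots> \<longleftrightarrow> (\<exists>j\<in>set_mset M - {1}. (\<sigma>, b) \<in> ?P j)"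
      proof
        assume "(\<sigma>, b) \<in> ?P (Suc ?k) \<and> Suc ?k \<in># M"
        then show "\<exists>j\<in>set_mset M - {1}. (\<sigma>, b) \<in> ?P j" using k by (intro bexI[of _ "Suc ?k"]) auto
      next
        assume "\<exists>j\<in>set_mset M - {1}. (\<sigma>, b) \<in> ?P j"
        then obtain j where j: "j \<in># M" "(\<sigma>, b) \<in> ?P j" by auto
        then have "j - 1 = ?k" by auto
        then have "j = Suc ?k" using k by simp
        then show "(\<sigma>, b) \<in> ?P (Suc ?k) \<and> Suc ?k \<in># M" using j by simp
      qed
      finally show ?thesis by (simp only: UN_iff)
    qed (auto simp: cyclic_completions_def)
    then show ?thesis by (intro set_eqI) (simp only: split_paired_all)
  qed
  also have "card \<dots> = (\<Sum>j\<in>set_mset M - {1}. card (?P j))"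
  proof (rule card_UN_disjoint)
    show "\<forall>i\<in>set_mset M - {1}. finite (?P i)"
      using X by (auto intro!: finite_SigmaI finite_cyclic_completions)
    show "\<forall>i\<in>set_mset M - {1}. \<forall>j\<in>set_mset M - {1}. i \<noteq> j \<longrightarrow> ?P i \<inter> ?P j = {}"
    proof (intro ballI impI)
      fix i j assume "i \<in> set_mset M - {1}" "j \<in> set_mset M - {1}" "i \<noteq> j"
      then have "i \<noteq> 0" "j \<noteq> 0" "i \<noteq> j" using M by (metis DiffD1)+
      then have "i - 1 \<noteq> j - 1" by simp
      then show "?P i \<inter> ?P j = {}" by auto
    qed
  qed simp
  also have "\<dots> = (\<Sum>j\<in>set_mset M - {1}. (j - 1) * count (?M j) (j - 1) * card (cyclic_completions ?Y w (?M j)))"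
  proof (rule sum.cong[OF refl])
    fix j
    have "card (?P j) = (\<Sum>\<sigma>\<in>cyclic_completions ?Y w (?M j). card {b \<in> ?Y. card (orbit \<sigma> b) = j - 1})"
      using X by (intro card_SigmaI finite_cyclic_completions) auto
    also have "\<dots> = (\<Sum>\<sigma>\<in>cyclic_completions ?Y w (?M j). (j - 1) * count (?M j) (j - 1))"
    proof (rule sum.cong[OF refl])
      fix \<sigma> assume "\<sigma> \<in> cyclic_completions ?Y w (?M j)"
      then show "card {b \<in> ?Y. card (orbit \<sigma> b) = j - 1} = (j - 1) * count (?M j) (j - 1)"
        using card_points_in_cycles[of \<sigma> ?Y "j - 1"] X unfolding cyclic_completions_def by simp
    qed
    finally show "card (?P j) = (j - 1) * count (?M j) (j - 1) * card (cyclic_completions ?Y w (?M j))"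
      by simp
  qed
  finally show ?thesis .
qed

text \<open>Here \<open>p\<close> is fixed by \<open>\<sigma>\<close> and moved by the left factor.
  Commuting the transposition past \<open>\<sigma>\<close> turns the product into
  \<open>w \<circ> \<sigma>\<close> with \<open>p\<close> inserted, which keeps the number of
  cycles.\<close>

lemma card_cyclic_completions_with_fixpoint:
  assumes X: "finite X" and p: "p \<in> X" and w: "w permutes (X - {p})" and q: "q \<in> X - {p}"
  shows "{\<sigma> \<in> cyclic_completions X (w \<circ> transpose p q) (add_mset 1 M). \<sigma> p = p} =
    cyclic_completions (X - {p}) w M"
proof -
  have "\<sigma> \<in> cyclic_completions X (w \<circ> transpose p q) (add_mset 1 M) \<longleftrightarrow>
      \<sigma> \<in> cyclic_completions (X - {p}) w M" if \<sigma>: "\<sigma> permutes (X - {p})" for \<sigma>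
  proof -
    have \<sigma>X: "\<sigma> permutes X" and \<sigma>p: "\<sigma> p = p"
      using \<sigma> permutes_remove_fixpoint[OF p] by auto
    have inv: "inv \<sigma> q \<in> X - {p}"
      using permutes_in_image[OF permutes_inv[OF \<sigma>]] q by blast
    have "transpose p q \<circ> \<sigma> = \<sigma> \<circ> transpose p (inv \<sigma> q)"
    proof
      fix x
      have "x = inv \<sigma> q \<longleftrightarrow> \<sigma> x = q"
        using permutes_inv_eq[OF \<sigma>, of q x] by auto
      moreover have "\<sigma> x = p \<longleftrightarrow> x = p"
        using \<sigma>p permutes_inj[OF \<sigma>] by (metis injD)
      ultimately show "(transpose p q \<circ> \<sigma>) x = (\<sigma> \<circ> transpose p (inv \<sigma> q)) x"
        using \<sigma>p permutes_inverses(1)[OF \<sigma>] by (auto simp: transpose_def)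
    qed
    then have "w \<circ> transpose p q \<circ> \<sigma> = (w \<circ> \<sigma>) \<circ> transpose p (inv \<sigma> q)"
      by (simp add: comp_assoc)
    then have "cyc X (w \<circ> transpose p q \<circ> \<sigma>) = cyc (X - {p}) (w \<circ> \<sigma>)"
      using insert_point_facts(2)[OF p X permutes_compose[OF \<sigma> w] inv] by simp
    then show ?thesis
      using \<sigma> \<sigma>X fixpoint_facts(3)[OF p X \<sigma>] by (simp add: cyclic_completions_def)
  qed
  moreover have "\<sigma> permutes X \<and> \<sigma> p = p \<longleftrightarrow> \<sigma> permutes (X - {p})" for \<sigma>
    by (rule permutes_remove_fixpoint[OF p])
  ultimately show ?thesis unfolding cyclic_completions_def by blast
qed

text \<open>With \<open>cyc X w = r + 1\<close> this is \<open>W w * r! * D / N\<close> for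
  \<open>D = N * m / size M\<close>, where \<open>m\<close> counts the arrangements of the cycle
  lengths in a row and \<open>size M\<close> is the number of cycles of
  \<open>\<sigma>\<close>.\<close>

definition predicted_completions :: "'a set \<Rightarrow> ('a \<Rightarrow> 'a) \<Rightarrow> nat multiset \<Rightarrow> real" where
  "predicted_completions X w M =
    cycle_weight X w * fact (cyc X w - 1) * real (card (permutations_of_multiset M)) / real (size M)"

text \<open>The case of a fixed point of \<open>w\<close>. In the recurrence over \<open>j\<close>,
  the hypothesis and the shift identity turn each term into \<open>(j - 1) * count M j\<close> times
  a common factor \<open>F\<close>. These numbers add up to
  \<open>card X - size M = cyc X w - 1\<close>, which completes the factorial in
  \<open>F\<close>.\<close>

lemma card_cyclic_completions_step_left:
  assumes X: "finite X" and c: "c \<in> X" and Y: "X - {c} \<noteq> {}" and w: "w permutes (X - {c})"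
    and sz: "cyc X w + size M = card X + 1" and sM: "sum_mset M = card X" and M0: "0 \<notin># M"
    and hyp: "\<And>N. cyc (X - {c}) w + size N = card (X - {c}) + 1 \<Longrightarrow> sum_mset N = card (X - {c}) \<Longrightarrow>
      0 \<notin># N \<Longrightarrow> real (card (cyclic_completions (X - {c}) w N)) = predicted_completions (X - {c}) w N"
  shows "real (card (cyclic_completions X w M)) = predicted_completions X w M"
proof -
  let ?Y = "X - {c}" and ?M = "\<lambda>j. add_mset (j - 1) (M - {#j#})"
  let ?m = "\<lambda>M. real (card (permutations_of_multiset M))"
  \<comment> \<open>Without \<open>c\<close> the permutation \<open>w\<close> has one cycle fewer,
    hence the 2 in the factorial.\<close>
  define F where "F = cycle_weight X w * fact (cyc X w - 2) * ?m M / real (size M)"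
  note f = fixpoint_facts[OF c X w]
  have cY: "Suc (card ?Y) = card X" using card_Suc_Diff1[OF X c] .
  have cyc2: "cyc X w \<ge> 2" using f(1) cyc_pos[of ?Y w] X Y by simp
  have IH: "real (count (?M j) (j - 1)) * real (card (cyclic_completions ?Y w (?M j))) = F * real (count M j)"
    if j: "j \<in># M" "j \<noteq> 1" for j
  proof -
    have "j \<noteq> 0" using j M0 by metis
    then have j2: "j \<ge> 2" using j by simp
    obtain Q where Q: "M = add_mset j Q" using j by (metis multi_member_split)
    define N where "N = ?M j"
    have N: "N = add_mset (j - 1) Q" unfolding N_def Q by simp
    have size: "size N = size M" unfolding N Q by simp
    have "sum_mset N = card ?Y" using sM cY j2 unfolding N Q by simp
    moreover have "0 \<notin># N" using j2 M0 unfolding N Q by simp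
    moreover have "cyc ?Y w + size N = card ?Y + 1" using size sz f(1) cY by linarith
    ultimately have "real (card (cyclic_completions ?Y w N)) = predicted_completions ?Y w N"
      using hyp by blast
    also have "\<dots> = cycle_weight X w * fact (cyc X w - 2) * ?m N / real (size M)"
      unfolding predicted_completions_def size f(1,2) by simp
    finally have "real (count N (j - 1)) * real (card (cyclic_completions ?Y w N)) =
      cycle_weight X w * fact (cyc X w - 2) * real (card (permutations_of_multiset N) * count N (j - 1)) / real (size M)"
      by simp
    then show ?thesis
      unfolding permutations_of_multiset_shift[OF j(1) N_def] F_def unfolding N_def by simp
  qed
  have "real (card (cyclic_completions X w M)) = (\<Sum>j\<in>set_mset M - {1}.
     real (j - 1) * (real (count (?M j) (j - 1)) * real (card (cyclic_completions ?Y w (?M j)))))"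
    unfolding card_cyclic_completions_fixpoint[OF X c Y w M0]
    by (simp only: of_nat_sum of_nat_mult mult.assoc)
  also have "\<dots> = (\<Sum>j\<in>set_mset M - {1}. (real j - 1) * (F * real (count M j)))"
  proof (rule sum.cong[OF refl])
    fix j assume "j \<in> set_mset M - {1}"
    then have j: "j \<in># M" "j \<noteq> 1" and "j \<noteq> 0" using M0 by (auto intro: gr0I)
    then have "real (j - 1) = real j - 1" by (simp add: of_nat_diff)
    then show "real (j - 1) * (real (count (?M j) (j - 1)) * real (card (cyclic_completions ?Y w (?M j)))) =
      (real j - 1) * (F * real (count M j))"
      unfolding IH[OF j] by (simp only:)
  qed
  also have "\<dots> = (\<Sum>j\<in>set_mset M. (real j - 1) * (F * real (count M j)))"
    by (rule sum.mono_neutral_left) auto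
  also have "\<dots> = F * (\<Sum>j\<in>set_mset M. (real j - 1) * real (count M j))"
    unfolding sum_distrib_left by (intro sum.cong refl) simp
  also have "(\<Sum>j\<in>set_mset M. (real j - 1) * real (count M j)) = real (cyc X w) - 1"
    unfolding sum_count_pred sM using arg_cong[OF sz, of real] by simp
  also have "F * (real (cyc X w) - 1) =
      cycle_weight X w * (fact (cyc X w - 2) * (real (cyc X w) - 1)) * ?m M / real (size M)"
    by (simp add: F_def)
  also have "fact (cyc X w - 2) * (real (cyc X w) - 1) = fact (cyc X w - 1)"
  proof -
    have "cyc X w - 1 = Suc (cyc X w - 2)" using cyc2 by simp
    then show ?thesis using cyc2 by (simp add: of_nat_diff algebra_simps)
  qed
  finally show ?thesis unfolding predicted_completions_def .
qed

text \<open>Pairs of a completion and one of its fixed points \<open>p\<close> are counted in two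
  ways. Deleting \<open>p\<close> from \<open>w\<close> shortens a cycle of length \<open>x\<close>
  and multiplies the weight by \<open>1 - 1/x\<close>, while every completion has
  \<open>count M 1\<close> fixed points.\<close>

lemma card_cyclic_completions_step_right:
  assumes X: "finite X" and w: "w permutes X" and nofix: "\<And>p. p \<in> X \<Longrightarrow> w p \<noteq> p"
    and sz: "cyc X w + size (add_mset 1 Q) = card X + 1" and Q0: "Q \<noteq> {#}"
    and hyp: "\<And>p u. p \<in> X \<Longrightarrow> u permutes (X - {p}) \<Longrightarrow> cyc (X - {p}) u = cyc X w \<Longrightarrow>
      real (card (cyclic_completions (X - {p}) u Q)) = predicted_completions (X - {p}) u Q"
  shows "real (card (cyclic_completions X w (add_mset 1 Q))) = predicted_completions X w (add_mset 1 Q)"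
proof -
  let ?m = "\<lambda>M. real (card (permutations_of_multiset M))"
  define M where "M = add_mset 1 Q"
  define F where "F = cycle_weight X w * fact (cyc X w - 1) * ?m Q"
  let ?S = "cyclic_completions X w M"
  have IH: "real (card {\<sigma> \<in> ?S. \<sigma> p = p}) = F / real (size Q) * (1 - 1 / card (orbit w p))"
    if p: "p \<in> X" for p
  proof -
    let ?Y = "X - {p}"
    \<comment> \<open>As \<open>w\<close> moves \<open>p\<close>, it arises from some
      \<open>u\<close> on the other points by inserting \<open>p\<close> after a point
      \<open>q\<close>.\<close>
    have "w \<in> {\<sigma>. \<sigma> permutes X \<and> \<sigma> p \<noteq> p}" using nofix p w by auto
    then obtain u q where u: "u permutes ?Y" "q \<in> ?Y" "w = u \<circ> transpose p q"
      unfolding bij_betw_imp_surj_on[OF bij_betw_insert_point[OF p], symmetric] by auto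
    note i = insert_point_facts[OF p X u(1,2), folded u(3)]
    have "real (card (cyclic_completions ?Y u Q)) = predicted_completions ?Y u Q"
      by (rule hyp[OF p u(1) i(2)[symmetric]])
    moreover have "cycle_weight ?Y u = cycle_weight X w * (1 - 1 / card (orbit w p))"
    proof -
      have "card (orbit u q) > 0" using card_orbit_pos[OF u(1)] X by simp
      then show ?thesis using i(3,5) by (simp add: field_simps)
    qed
    moreover have "{\<sigma> \<in> ?S. \<sigma> p = p} = cyclic_completions ?Y u Q"
      unfolding M_def u(3) by (rule card_cyclic_completions_with_fixpoint[OF X p u(1,2)])
    ultimately show ?thesis
      unfolding predicted_completions_def F_def i(2) by simp
  qed
  \<comment> \<open>By \<open>sz\<close> both sides are the number of points minus
    \<open>cyc X w\<close>.\<close>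
  have sumQ: "(\<Sum>p\<in>X. 1 - 1 / real (card (orbit w p))) = real (size Q)"
    using sum_inverse_card_orbit[OF w X] arg_cong[OF sz, of real] by (simp add: sum_subtractf)
  have "real (\<Sum>\<sigma>\<in>?S. card {p \<in> X. \<sigma> p = p}) = real (\<Sum>p\<in>X. card {\<sigma> \<in> ?S. \<sigma> p = p})"
    using sum_multicount_gen[OF finite_cyclic_completions[OF X] X, of w M "\<lambda>\<sigma> p. \<sigma> p = p" "\<lambda>p. card {\<sigma> \<in> ?S. \<sigma> p = p}"] by simp
  also have "\<dots> = (\<Sum>p\<in>X. F / real (size Q) * (1 - 1 / real (card (orbit w p))))"
    unfolding of_nat_sum by (intro sum.cong refl IH)
  also have "\<dots> = F / real (size Q) * real (size Q)"
    unfolding sum_distrib_left[symmetric] sumQ ..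
  also have "\<dots> = F" using Q0 by simp
  also have "(\<Sum>\<sigma>\<in>?S. card {p \<in> X. \<sigma> p = p}) = (\<Sum>\<sigma>\<in>?S. count M 1)"
    by (rule sum.cong) (auto simp: cyclic_completions_def card_fixpoints[OF _ X])
  finally have a: "real (card ?S) * real (count M 1) = F" by simp
  \<comment> \<open>Arrangements of \<open>M\<close> with a marked entry 1 correspond to
    arrangements of \<open>Q\<close> with one of \<open>size M\<close> places for the marked
    entry.\<close>
  have "1 \<in># M" "M - {#1#} = Q" by (simp_all add: M_def)
  then have b: "?m M * real (count M 1) = real (size M) * ?m Q"
    using card_permutations_of_multiset_remove_aux[of 1 M] by (metis of_nat_mult)
  have "(real (card ?S) * real (size M)) * real (count M 1) = real (size M) * F"
    unfolding a[symmetric] by (simp only: mult_ac)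
  also have "\<dots> = (cycle_weight X w * fact (cyc X w - 1) * ?m M) * real (count M 1)"
    unfolding mult.assoc b F_def by (simp only: mult_ac)
  finally have "real (card ?S) * real (size M) = cycle_weight X w * fact (cyc X w - 1) * ?m M"
    by (simp add: M_def)
  moreover have "real (size M) \<noteq> 0" by (simp add: M_def)
  ultimately show ?thesis
    unfolding predicted_completions_def M_def[symmetric] by (subst nonzero_eq_divide_eq)
qed

lemma twice_cyc_le_card:
  assumes w: "w permutes X" and X: "finite X" and nofix: "\<And>p. p \<in> X \<Longrightarrow> w p \<noteq> p"
  shows "2 * cyc X w \<le> card X"
proof -
  have "2 \<le> card C" if C: "C \<in> cycles_on X w" for C
  proof -
    obtain x where x: "x \<in> X" "C = orbit w x" using C by (auto simp: cycles_on_def)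
    have "{x, w x} \<subseteq> C" using x permutes_self_in_orbit[OF w X] by (simp add: orbit.base)
    moreover have "card {x, w x} = 2" using nofix[OF x(1)] by (metis card_2_iff)
    ultimately show ?thesis using card_mono[OF cycles_on_facts(3)[OF w X C]] by metis
  qed
  then have "(\<Sum>C\<in>cycles_on X w. 2) \<le> (\<Sum>C\<in>cycles_on X w. card C)" by (rule sum_mono)
  then show ?thesis using sum_card_cycles[OF w X] by (simp add: cyc_def)
qed

lemma size_le_sum_mset: "0 \<notin># M \<Longrightarrow> size M \<le> sum_mset (M :: nat multiset)"
  by (induction M) auto

lemma twice_size_le_sum_mset:
  assumes "0 \<notin># M" "1 \<notin># M"
  shows "2 * size M \<le> sum_mset (M :: nat multiset)"
  using assms
proof (induction M)
  case (add x M)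
  then have "x \<noteq> 0" "x \<noteq> 1" by auto
  then show ?case using add by simp
qed simp

text \<open>Induction on the number of points. If \<open>w\<close> has no fixed point, its cycles
  have length at least 2, so \<open>2 * cyc X w \<le> card X\<close> and \<open>2 * size M\<close>
  exceeds \<open>card X = sum_mset M\<close>. Hence some entry of \<open>M\<close> is 1, and every
  completion has a fixed point.\<close>

lemma card_cyclic_completions:
  assumes "finite X" "w permutes X" "cyc X w + size M = card X + 1" "sum_mset M = card X" "0 \<notin># M"
  shows "real (card (cyclic_completions X w M)) = predicted_completions X w M"
  using assms
proof (induction "card X" arbitrary: X w M rule: less_induct)
  case less
  note X = \<open>finite X\<close> and w = \<open>w permutes X\<close> and sz = \<open>cyc X w + size M = card X + 1\<close>
    and sM = \<open>sum_mset M = card X\<close> and M0 = \<open>0 \<notin># M\<close>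
  have "size M \<ge> 1" using sz cyc_le_card[OF X, of w] by simp
  have "card X \<ge> 1" using size_le_sum_mset[OF M0] sM \<open>size M \<ge> 1\<close> by simp
  then have K1: "cyc X w \<ge> 1" using cyc_pos[OF X, of w] by fastforce
  show ?case
  proof (cases "card X = 1")
    case True
    then obtain x where x: "X = {x}" by (metis card_1_singletonE)
    have "cyc X w = 1" using K1 cyc_le_card[OF X, of w] True by simp
    then have "size M = 1" using sz True by simp
    then obtain k where "M = {#k#}" by (metis size_1_singleton_mset)
    then have M: "M = {#1#}" using sM True by simp
    have w_id: "w = id" using w x by simp
    have "cyclic_completions X w M = {id}"
      using x by (auto simp: cyclic_completions_def M w_id cyc_id cycle_type_def cycles_on_id)
    then show ?thesis using M by (simp add: w_id cycle_weight_id cyc_id True predicted_completions_def)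
  next
    case False
    then have X2: "card X \<ge> 2" using \<open>card X \<ge> 1\<close> by simp
    have cY: "Suc (card (X - {p})) = card X" if "p \<in> X" for p
      using card_Suc_Diff1[OF X that] .
    show ?thesis
    proof (cases "\<exists>c\<in>X. w c = c")
      case True
      then obtain c where c: "c \<in> X" "w c = c" by auto
      have "w permutes (X - {c})" using w c permutes_remove_fixpoint[OF c(1)] by blast
      moreover have "X - {c} \<noteq> {}" using X2 cY[OF c(1)] by fastforce
      ultimately show ?thesis
        using cY[OF c(1)] X by (intro card_cyclic_completions_step_left[OF X c(1) _ _ sz sM M0] less.hyps) auto
    next
      case False
      then have nofix: "\<And>p. p \<in> X \<Longrightarrow> w p \<noteq> p" by auto
      have "2 * cyc X w \<le> card X" by (rule twice_cyc_le_card[OF w X nofix])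
      then have "1 \<in># M" using twice_size_le_sum_mset[OF M0] sz sM by fastforce
      then obtain Q where Q: "M = add_mset 1 Q" by (metis multi_member_split)
      have "Q \<noteq> {#}" using X2 sM unfolding Q by auto
      moreover have "real (card (cyclic_completions (X - {p}) u Q)) = predicted_completions (X - {p}) u Q"
        if p: "p \<in> X" "u permutes (X - {p})" "cyc (X - {p}) u = cyc X w" for p u
      proof (rule less.hyps)
        show "cyc (X - {p}) u + size Q = card (X - {p}) + 1" using p(3) sz cY[OF p(1)] unfolding Q by simp
        show "sum_mset Q = card (X - {p})" using sM cY[OF p(1)] unfolding Q by simp
        show "0 \<notin># Q" using M0 unfolding Q by simp
      qed (use p X cY[OF p(1)] in auto)
      ultimately show ?thesis
        using card_cyclic_completions_step_right[OF X w nofix sz[unfolded Q]] unfolding Q by blast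
    qed
  qed
qed

section \<open>Subadditivity of the rank\<close>

lemma permutes_comp_transpose:
  "p permutes X \<Longrightarrow> a \<in> X \<Longrightarrow> b \<in> X \<Longrightarrow> p \<circ> transpose a b permutes X"
  by (intro permutes_compose permutes_swap_id)

text \<open>Deleting a moved point splits off a transposition and raises the number of cycles by
  one. So every permutation is built from \<open>id\<close> by transpositions each of which joins
  two cycles.\<close>

lemma permutes_rank_induct [consumes 2, case_names id transpose]:
  assumes \<sigma>: "\<sigma> permutes X" and X: "finite X"
    and "P id"
    and step: "\<And>\<tau> a b. \<tau> permutes X \<Longrightarrow> a \<in> X \<Longrightarrow> b \<in> X \<Longrightarrow> a \<noteq> b \<Longrightarrow>
      Suc (cyc X (\<tau> \<circ> transpose a b)) = cyc X \<tau> \<Longrightarrow> P \<tau> \<Longrightarrow> P (\<tau> \<circ> transpose a b)"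
  shows "P \<sigma>"
  using \<sigma>
proof (induction "card X - cyc X \<sigma>" arbitrary: \<sigma> rule: less_induct)
  case less
  show ?case
  proof (cases "\<sigma> = id")
    case False
    then obtain a where a: "a \<in> X" "\<sigma> a \<noteq> a"
      using less.prems by (metis eq_id_iff permutes_not_in)
    then have "\<sigma> \<in> {\<sigma>. \<sigma> permutes X \<and> \<sigma> a \<noteq> a}" using less.prems by simp
    then obtain \<tau> b where \<tau>: "\<tau> permutes (X - {a})" "b \<in> X - {a}" "\<sigma> = \<tau> \<circ> transpose a b"
      unfolding bij_betw_imp_surj_on[OF bij_betw_insert_point[OF a(1)], symmetric] by auto
    have \<tau>X: "\<tau> permutes X" using \<tau>(1) permutes_remove_fixpoint[OF a(1)] by blast
    have cyc: "Suc (cyc X \<sigma>) = cyc X \<tau>"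
      using insert_point_facts(2)[OF a(1) X \<tau>(1,2)] fixpoint_facts(1)[OF a(1) X \<tau>(1)] \<tau>(3) by simp
    have "P \<tau>"
      using cyc cyc_le_card[OF X, of \<tau>] by (intro less.hyps \<tau>X) simp
    then show ?thesis
      using step[OF \<tau>X a(1), of b] \<tau> cyc by auto
  qed (use \<open>P id\<close> in simp)
qed

text \<open>Subadditivity of the rank. While \<open>\<sigma>\<close> is built from
  \<open>id\<close>, each transposition costs \<open>\<sigma>\<close> exactly one cycle and
  \<open>w \<circ> \<sigma>\<close> at most one.\<close>

lemma cyc_comp_ge:
  assumes X: "finite X" and w: "w permutes X" and \<sigma>: "\<sigma> permutes X"
  shows "cyc X w + cyc X \<sigma> \<le> cyc X (w \<circ> \<sigma>) + card X"
  using \<sigma> X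
proof (induction rule: permutes_rank_induct)
  case (transpose \<tau> a b)
  have "cyc X (w \<circ> \<tau>) \<le> Suc (cyc X (w \<circ> \<tau> \<circ> transpose a b))"
    using transpose w X by (intro cyc_le_Suc_comp_transpose permutes_compose)
  then show ?case using transpose.IH transpose.hyps(5) unfolding comp_assoc by linarith
qed (simp only: cyc_id comp_id order_refl)

section \<open>Products of lists of permutations\<close>

lemma perm_product_Nil [simp]: "perm_product [] = id"
  and perm_product_Cons [simp]: "perm_product (x # xs) = x \<circ> perm_product xs"
  by (simp_all add: perm_product_def)

lemma perm_product_append: "perm_product (xs @ ys) = perm_product xs \<circ> perm_product ys"
  by (induction xs) (simp_all add: comp_assoc)

lemma perm_product_concat: "perm_product (concat xss) = perm_product (map perm_product xss)"
  by (induction xss) (simp_all add: perm_product_append)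

section \<open>Uniform families\<close>

text \<open>The rule with constant \<open>D\<close>, written without division; for
  \<open>r < cyc X w\<close> no subtraction in it truncates. Indices are used because different
  factorisations may have the same product. Ranks are only bounded by \<open>r\<close>, as
  subadditivity gives no more for products.\<close>

definition uniform_family :: "'a set \<Rightarrow> 'i set \<Rightarrow> ('i \<Rightarrow> 'a \<Rightarrow> 'a) \<Rightarrow> nat \<Rightarrow> real \<Rightarrow> bool" where
  "uniform_family X I f r D \<longleftrightarrow> finite I \<and>
    (\<forall>i\<in>I. f i permutes X \<and> card X \<le> cyc X (f i) + r) \<and>
    (\<forall>w. w permutes X \<longrightarrow> r < cyc X w \<longrightarrow>
      (\<Sum>i | i \<in> I \<and> cyc X (w \<circ> f i) + r = cyc X w. cycle_weight X (w \<circ> f i)) * fact (cyc X w - r - 1) =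
      cycle_weight X w * fact (cyc X w - 1) * D)"

lemma uniform_familyD:
  assumes "uniform_family X I f r D"
  shows "finite I" "\<And>i. i \<in> I \<Longrightarrow> f i permutes X" "\<And>i. i \<in> I \<Longrightarrow> card X \<le> cyc X (f i) + r"
    "\<And>w. w permutes X \<Longrightarrow> r < cyc X w \<Longrightarrow>
      (\<Sum>i | i \<in> I \<and> cyc X (w \<circ> f i) + r = cyc X w. cycle_weight X (w \<circ> f i)) * fact (cyc X w - r - 1) =
      cycle_weight X w * fact (cyc X w - 1) * D"
  using assms by (auto simp: uniform_family_def)

lemma uniform_family_cyc_ge:
  assumes "finite X" "w permutes X" "f i permutes X" "card X \<le> cyc X (f i) + r"
  shows "cyc X w \<le> cyc X (w \<circ> f i) + r"
  using cyc_comp_ge[OF assms(1-3)] assms(4) by simp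

lemma comp_transpose_conv:
  assumes "inj p"
  shows "transpose (p a) (p b) \<circ> p = p \<circ> transpose a b"
proof
  fix x
  show "(transpose (p a) (p b) \<circ> p) x = (p \<circ> transpose a b) x"
    using inj_eq[OF assms] by (auto simp: transpose_def)
qed

text \<open>Multiplying by one more transposition and commuting it to the left of the family
  reduces the number of cycles of \<open>w\<close>, down to the case of a cyclic product.\<close>

lemma uniform_familyI:
  fixes f :: "'i \<Rightarrow> 'a \<Rightarrow> 'a"
  assumes X: "finite X" "X \<noteq> {}" and I: "finite I"
    and f: "\<And>i. i \<in> I \<Longrightarrow> f i permutes X" "\<And>i. i \<in> I \<Longrightarrow> card X \<le> cyc X (f i) + r"
    and base: "\<And>w. w permutes X \<Longrightarrow> cyc X w = Suc r \<Longrightarrow>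
      real (card {i \<in> I. cyc X (w \<circ> f i) = 1}) * card X = cycle_weight X w * fact r * D"
  shows "uniform_family X I f r D"
proof -
  define S where "S w = (\<Sum>i | i \<in> I \<and> cyc X (w \<circ> f i) + r = cyc X w. cycle_weight X (w \<circ> f i))" for w
  have N0: "card X > 0" using X by (simp add: card_gt_0_iff)
  \<comment> \<open>\<open>k\<close> measures how far \<open>w\<close> is from the base case of
    \<open>r + 1\<close> cycles, where the product is a full cycle.\<close>
  have main: "S w * fact k = cycle_weight X w * fact (r + k) * D"
    if "w permutes X" "cyc X w = Suc (r + k)" for w k
    using that
  proof (induction k arbitrary: w)
    case 0
    have "S w = (\<Sum>i\<in>{i \<in> I. cyc X (w \<circ> f i) = 1}. real (card X))"
      unfolding S_def
    proof (rule sum.cong)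
      show "{i. i \<in> I \<and> cyc X (w \<circ> f i) + r = cyc X w} = {i \<in> I. cyc X (w \<circ> f i) = 1}"
        using 0 by auto
      fix i assume "i \<in> {i \<in> I. cyc X (w \<circ> f i) = 1}"
      then show "cycle_weight X (w \<circ> f i) = real (card X)"
        using 0 f X by (intro cycle_weight_cyclic permutes_compose) auto
    qed
    then show ?case using base 0 by simp
  next
    case (Suc k)
    note w = Suc.prems(1)
    let ?c = "cyc X" and ?W = "cycle_weight X"
    let ?T = "\<lambda>u. {(a, b). (a, b) \<in> X \<times> X \<and> Suc (?c (u \<circ> transpose a b)) = ?c u}"
    let ?I = "{i. i \<in> I \<and> ?c (w \<circ> f i) + r = ?c w}"
    have finT: "finite (?T u)" for u
      by (rule finite_subset[of _ "X \<times> X"]) (use X in auto)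
    \<comment> \<open>\<open>P\<close> multiplies by the transposition after the member of the
      family, \<open>Q\<close> before it; in both a total of \<open>r + 1\<close> cycles is
      lost.\<close>
    define P where "P = {(i, (a, b)). i \<in> I \<and> (a, b) \<in> X \<times> X \<and>
      ?c (w \<circ> f i \<circ> transpose a b) + r + 1 = ?c w}"
    define Q where "Q = {((a, b), i). i \<in> I \<and> (a, b) \<in> X \<times> X \<and>
      ?c (w \<circ> transpose a b \<circ> f i) + r + 1 = ?c w}"
    \<comment> \<open>The family costs at most \<open>r\<close> cycles and the transposition at most
      one, so a total loss of \<open>r + 1\<close> forces the maximum in each step.\<close>
    have P: "P = Sigma ?I (\<lambda>i. ?T (w \<circ> f i))"
    proof -
      have "?c (w \<circ> f i \<circ> transpose a b) + r + 1 = ?c w \<longleftrightarrow>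
          ?c (w \<circ> f i) + r = ?c w \<and> Suc (?c (w \<circ> f i \<circ> transpose a b)) = ?c (w \<circ> f i)"
        if "i \<in> I" "a \<in> X" "b \<in> X" for i a b
        using uniform_family_cyc_ge[of X w f i r, OF X(1) w f(1)[OF that(1)] f(2)[OF that(1)]]
          cyc_le_Suc_comp_transpose[OF permutes_compose[OF f(1)[OF that(1)] w] X(1) that(2,3)]
        by auto
      then show ?thesis unfolding P_def by auto
    qed
    have Q: "Q = Sigma (?T w) (\<lambda>(a, b). {i. i \<in> I \<and> ?c (w \<circ> transpose a b \<circ> f i) + r = ?c (w \<circ> transpose a b)})"
    proof -
      have "?c (w \<circ> transpose a b \<circ> f i) + r + 1 = ?c w \<longleftrightarrow>
          Suc (?c (w \<circ> transpose a b)) = ?c w \<and>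
          ?c (w \<circ> transpose a b \<circ> f i) + r = ?c (w \<circ> transpose a b)"
        if "i \<in> I" "a \<in> X" "b \<in> X" for i a b
        using uniform_family_cyc_ge[of X "w \<circ> transpose a b" f i r,
            OF X(1) permutes_comp_transpose[OF w that(2,3)] f(1)[OF that(1)] f(2)[OF that(1)]]
          cyc_le_Suc_comp_transpose[OF w X(1) that(2,3)]
        by auto
      then show ?thesis unfolding Q_def by auto
    qed
    \<comment> \<open>\<open>w \<circ> f i\<close> has \<open>k + 2\<close> cycles, so the sum over
      the merging transpositions carries the factor \<open>k + 1\<close>.\<close>
    have "2 * card X * (real k + 1) * S w = (\<Sum>i\<in>?I. \<Sum>(a, b)\<in>?T (w \<circ> f i). ?W (w \<circ> f i \<circ> transpose a b))"
      unfolding S_def sum_distrib_left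
    proof (rule sum.cong[OF refl])
      fix i assume i: "i \<in> ?I"
      then have "real (?c (w \<circ> f i)) - 1 = real k + 1" using Suc.prems(2) by simp
      then show "2 * card X * (real k + 1) * ?W (w \<circ> f i) =
        (\<Sum>(a, b)\<in>?T (w \<circ> f i). ?W (w \<circ> f i \<circ> transpose a b))"
        using sum_transpose_merge[OF permutes_compose[OF f(1) w] X(1), of i] i by (simp only: mem_Collect_eq) (simp only: mult_ac of_nat_mult)
    qed
    also have "\<dots> = (\<Sum>(i, (a, b))\<in>P. ?W (w \<circ> f i \<circ> transpose a b))"
      unfolding P using I finT by (subst sum.Sigma) (auto simp: case_prod_beta)
    also have "\<dots> = (\<Sum>((a, b), i)\<in>Q. ?W (w \<circ> transpose a b \<circ> f i))"
    proof -
      \<comment> \<open>Conjugation by \<open>f i\<close> moves the transposition across: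
        \<open>transpose (f i a) (f i b) \<circ> f i = f i \<circ> transpose a b\<close>. The map
        \<open>ret\<close> undoes this.\<close>
      define to where "to = (\<lambda>(i, (a, b)). ((f i a, f i b), i))"
      define ret where "ret = (\<lambda>((a, b), i). (i, (inv (f i) a, inv (f i) b)))"
      define h where "h = (\<lambda>((a, b), i). ?W (w \<circ> transpose a b \<circ> f i))"
      have 1: "ret (to x) = x \<and> to x \<in> Q \<and>
          h (to x) = (case x of (i, (a, b)) \<Rightarrow> ?W (w \<circ> f i \<circ> transpose a b))" if xP: "x \<in> P" for x
      proof -
        obtain i a b where x: "x = (i, (a, b))" "i \<in> I" "a \<in> X" "b \<in> X"
          "?c (w \<circ> f i \<circ> transpose a b) + r + 1 = ?c w" using xP unfolding P_def by auto
        note p = f(1)[OF x(2)]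
        have e: "w \<circ> transpose (f i a) (f i b) \<circ> f i = w \<circ> f i \<circ> transpose a b"
          by (simp add: comp_assoc comp_transpose_conv[OF permutes_inj[OF p]])
        have "to x \<in> Q"
          using x(2-5) permutes_in_image[OF p]
          unfolding Q_def x(1) to_def prod.case mem_Collect_eq mem_Times_iff fst_conv snd_conv e by blast
        moreover have "ret (to x) = x"
          using x permutes_inverses(2)[OF p] by (simp add: ret_def to_def)
        ultimately show ?thesis unfolding x(1) to_def h_def prod.case e by blast
      qed
      have 2: "to (ret y) = y \<and> ret y \<in> P" if yQ: "y \<in> Q" for y
      proof -
        obtain i a b where y: "y = ((a, b), i)" "i \<in> I" "a \<in> X" "b \<in> X"
          "?c (w \<circ> transpose a b \<circ> f i) + r + 1 = ?c w" using yQ unfolding Q_def by auto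
        note p = f(1)[OF y(2)]
        have "transpose a b \<circ> f i = f i \<circ> transpose (inv (f i) a) (inv (f i) b)"
          using comp_transpose_conv[OF permutes_inj[OF p], of "inv (f i) a" "inv (f i) b"]
          by (simp add: permutes_inverses(1)[OF p])
        then have e: "w \<circ> f i \<circ> transpose (inv (f i) a) (inv (f i) b) = w \<circ> transpose a b \<circ> f i"
          by (simp add: comp_assoc)
        have "ret y \<in> P"
          using y(2-5) permutes_in_image[OF permutes_inv[OF p]]
          unfolding P_def y(1) ret_def prod.case mem_Collect_eq mem_Times_iff fst_conv snd_conv e by blast
        then show ?thesis
          using y permutes_inverses(1)[OF p] by (simp add: ret_def to_def)
      qed
      show ?thesis
        unfolding h_def[symmetric]
        by (rule sum.reindex_bij_witness[where i = ret and j = to]) (simp_all only: 1 2)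
    qed
    also have "\<dots> = (\<Sum>(a, b)\<in>?T w. S (w \<circ> transpose a b))"
      unfolding Q S_def case_prod_beta using I X(1) by (subst sum.Sigma) (auto simp: case_prod_beta)
    finally have "2 * card X * (real k + 1) * S w * fact k = (\<Sum>(a, b)\<in>?T w. S (w \<circ> transpose a b) * fact k)"
      by (simp add: sum_distrib_right case_prod_beta)
    also have "\<dots> = (\<Sum>(a, b)\<in>?T w. ?W (w \<circ> transpose a b) * (fact (r + k) * D))"
    proof (rule sum.cong[OF refl])
      fix x assume "x \<in> ?T w"
      then obtain a b where x: "x = (a, b)" "a \<in> X" "b \<in> X" "Suc (?c (w \<circ> transpose a b)) = ?c w" by auto
      have "?c (w \<circ> transpose a b) = Suc (r + k)" using x(4) Suc.prems(2) by linarith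
      then have "S (w \<circ> transpose a b) * fact k = ?W (w \<circ> transpose a b) * fact (r + k) * D"
        by (intro Suc.IH permutes_comp_transpose w x(2,3))
      then show "(case x of (a, b) \<Rightarrow> S (w \<circ> transpose a b) * fact k) =
        (case x of (a, b) \<Rightarrow> ?W (w \<circ> transpose a b) * (fact (r + k) * D))" using x(1) by simp
    qed
    also have "\<dots> = 2 * ?W w * card X * (real (?c w) - 1) * (fact (r + k) * D)"
      unfolding sum_transpose_merge[OF w X(1), symmetric] by (simp add: sum_distrib_right case_prod_beta)
    \<comment> \<open>This factor extends \<open>fact (r + k)\<close>, as \<open>k + 1\<close>
      extends \<open>fact k\<close> on the left; the common factor \<open>2 * card X\<close> is
      cancelled.\<close>
    also have "real (?c w) - 1 = real (Suc (r + k))" using Suc.prems(2) by simp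
    finally have "2 * real (card X) * (S w * fact (Suc k)) = 2 * real (card X) * (?W w * fact (r + Suc k) * D)"
      by (simp add: algebra_simps)
    then show ?case using N0 by simp
  qed
  show ?thesis
    unfolding uniform_family_def
  proof (intro conjI ballI allI impI)
    fix w assume w: "w permutes X" "r < cyc X w"
    have "S w * fact (cyc X w - r - 1) = cycle_weight X w * fact (r + (cyc X w - r - 1)) * D"
      using w by (intro main) auto
    moreover have "r + (cyc X w - r - 1) = cyc X w - 1" using w by simp
    ultimately show "(\<Sum>i | i \<in> I \<and> cyc X (w \<circ> f i) + r = cyc X w. cycle_weight X (w \<circ> f i)) * fact (cyc X w - r - 1) =
      cycle_weight X w * fact (cyc X w - 1) * D" unfolding S_def by simp
  qed (use I f in auto)
qed

text \<open>A total loss of \<open>r + s\<close> cycles forces a loss of \<open>r\<close> by the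
  first factor and of \<open>s\<close> by the second. The second rule is applied to
  \<open>w \<circ> f i\<close>, which has \<open>cyc X w - r\<close> cycles, so the factorials
  telescope.\<close>

lemma uniform_family_prod:
  assumes X: "finite X" and I: "uniform_family X I f r D" and J: "uniform_family X J g s E"
  shows "uniform_family X (I \<times> J) (\<lambda>(i, j). f i \<circ> g j) (r + s) (D * E)"
  unfolding uniform_family_def
proof (intro conjI ballI allI impI)
  note fI = uniform_familyD[OF I] and gJ = uniform_familyD[OF J]
  show "finite (I \<times> J)" using fI(1) gJ(1) by simp
  fix x assume "x \<in> I \<times> J"
  then obtain i j where x: "x = (i, j)" "i \<in> I" "j \<in> J" by auto
  show "(case x of (i, j) \<Rightarrow> f i \<circ> g j) permutes X"
    using x fI(2) gJ(2) by (auto intro: permutes_compose)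
  show "card X \<le> cyc X (case x of (i, j) \<Rightarrow> f i \<circ> g j) + (r + s)"
    using cyc_comp_ge[OF X fI(2)[OF x(2)] gJ(2)[OF x(3)]] fI(3)[OF x(2)] gJ(3)[OF x(3)] x(1) by simp
next
  note fI = uniform_familyD[OF I] and gJ = uniform_familyD[OF J]
  fix w assume w: "w permutes X" "r + s < cyc X w"
  let ?c = "cyc X" and ?W = "cycle_weight X"
  let ?I = "{i. i \<in> I \<and> ?c (w \<circ> f i) + r = ?c w}"
  let ?J = "\<lambda>u. {j. j \<in> J \<and> ?c (u \<circ> g j) + s = ?c u}"
  have "{x. x \<in> I \<times> J \<and> ?c (w \<circ> (case x of (i, j) \<Rightarrow> f i \<circ> g j)) + (r + s) = ?c w} =
    Sigma ?I (\<lambda>i. ?J (w \<circ> f i))"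
  proof -
    have "?c (w \<circ> (f i \<circ> g j)) + (r + s) = ?c w \<longleftrightarrow>
      ?c (w \<circ> f i) + r = ?c w \<and> ?c (w \<circ> f i \<circ> g j) + s = ?c (w \<circ> f i)" if "i \<in> I" "j \<in> J" for i j
      using uniform_family_cyc_ge[of X w f i r, OF X w(1) fI(2,3)[OF that(1)]]
        uniform_family_cyc_ge[of X "w \<circ> f i" g j s, OF X permutes_compose[OF fI(2)[OF that(1)] w(1)] gJ(2,3)[OF that(2)]]
      unfolding comp_assoc by auto
    then show ?thesis by auto
  qed
  then have "(\<Sum>x | x \<in> I \<times> J \<and> ?c (w \<circ> (case x of (i, j) \<Rightarrow> f i \<circ> g j)) + (r + s) = ?c w.
      ?W (w \<circ> (case x of (i, j) \<Rightarrow> f i \<circ> g j))) =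
    (\<Sum>(i, j)\<in>Sigma ?I (\<lambda>i. ?J (w \<circ> f i)). ?W (w \<circ> f i \<circ> g j))"
    by (intro sum.cong) (auto simp: comp_assoc)
  also have "\<dots> = (\<Sum>i\<in>?I. \<Sum>j\<in>?J (w \<circ> f i). ?W (w \<circ> f i \<circ> g j))"
    using fI(1) gJ(1) by (subst sum.Sigma) auto
  finally have "(\<Sum>x | x \<in> I \<times> J \<and> ?c (w \<circ> (case x of (i, j) \<Rightarrow> f i \<circ> g j)) + (r + s) = ?c w.
      ?W (w \<circ> (case x of (i, j) \<Rightarrow> f i \<circ> g j))) * fact (?c w - (r + s) - 1) =
    (\<Sum>i\<in>?I. (\<Sum>j\<in>?J (w \<circ> f i). ?W (w \<circ> f i \<circ> g j)) * fact (?c w - (r + s) - 1))"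
    by (simp add: sum_distrib_right)
  also have "\<dots> = (\<Sum>i\<in>?I. ?W (w \<circ> f i) * (fact (?c w - r - 1) * E))"
  proof (rule sum.cong[OF refl])
    fix i assume i: "i \<in> ?I"
    then have e: "?c (w \<circ> f i) = ?c w - r" unfolding mem_Collect_eq by linarith
    have "(\<Sum>j\<in>?J (w \<circ> f i). ?W (w \<circ> f i \<circ> g j)) * fact (?c (w \<circ> f i) - s - 1) =
      ?W (w \<circ> f i) * fact (?c (w \<circ> f i) - 1) * E"
      using i w e by (intro gJ(4) permutes_compose fI(2)) auto
    then show "(\<Sum>j\<in>?J (w \<circ> f i). ?W (w \<circ> f i \<circ> g j)) * fact (?c w - (r + s) - 1) =
      ?W (w \<circ> f i) * (fact (?c w - r - 1) * E)"
      unfolding e by simp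
  qed
  also have "\<dots> = (\<Sum>i\<in>?I. ?W (w \<circ> f i)) * fact (?c w - r - 1) * E"
    by (simp add: sum_distrib_right mult.assoc)
  also have "(\<Sum>i\<in>?I. ?W (w \<circ> f i)) * fact (?c w - r - 1) = ?W w * fact (?c w - 1) * D"
    using w by (intro fI(4)) auto
  finally show "(\<Sum>x | x \<in> I \<times> J \<and> ?c (w \<circ> (case x of (i, j) \<Rightarrow> f i \<circ> g j)) + (r + s) = ?c w.
      ?W (w \<circ> (case x of (i, j) \<Rightarrow> f i \<circ> g j))) * fact (?c w - (r + s) - 1) =
    ?W w * fact (?c w - 1) * (D * E)" by (simp only: mult.assoc)
qed

lemma uniform_family_reindex:
  assumes "uniform_family X I f r D" and h: "bij_betw h I J" and g: "\<And>i. i \<in> I \<Longrightarrow> g (h i) = f i"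
  shows "uniform_family X J g r D"
  unfolding uniform_family_def
proof (intro conjI ballI allI impI)
  note fI = uniform_familyD[OF assms(1)]
  show "finite J" using fI(1) bij_betw_finite[OF h] by simp
  fix j assume "j \<in> J"
  then obtain i where "i \<in> I" "j = h i" using h by (auto simp: bij_betw_def)
  then show "g j permutes X" "card X \<le> cyc X (g j) + r" using fI(2,3) g by auto
next
  note fI = uniform_familyD[OF assms(1)]
  fix w assume w: "w permutes X" "r < cyc X w"
  have "(\<Sum>j | j \<in> J \<and> cyc X (w \<circ> g j) + r = cyc X w. cycle_weight X (w \<circ> g j)) =
    (\<Sum>i | i \<in> I \<and> cyc X (w \<circ> f i) + r = cyc X w. cycle_weight X (w \<circ> f i))"
  proof -
    have "bij_betw h {i. i \<in> I \<and> cyc X (w \<circ> f i) + r = cyc X w} {j. j \<in> J \<and> cyc X (w \<circ> g j) + r = cyc X w}"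
      using h g unfolding bij_betw_def inj_on_def by force
    from sum.reindex_bij_betw[OF this, of "\<lambda>j. cycle_weight X (w \<circ> g j)", symmetric]
    show ?thesis by (rule trans) (intro sum.cong, auto simp: g)
  qed
  then show "(\<Sum>j | j \<in> J \<and> cyc X (w \<circ> g j) + r = cyc X w. cycle_weight X (w \<circ> g j)) * fact (cyc X w - r - 1) =
    cycle_weight X w * fact (cyc X w - 1) * D"
    using fI(4)[OF w] by simp
qed

lemma uniform_family_Union:
  assumes "finite A" "\<And>a. a \<in> A \<Longrightarrow> uniform_family X (I a) f r (D a)"
    and disj: "\<And>a b. a \<in> A \<Longrightarrow> b \<in> A \<Longrightarrow> a \<noteq> b \<Longrightarrow> I a \<inter> I b = {}"
  shows "uniform_family X (\<Union>a\<in>A. I a) f r (\<Sum>a\<in>A. D a)"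
  unfolding uniform_family_def
proof (intro conjI ballI allI impI)
  note fI = uniform_familyD[OF assms(2)]
  show "finite (\<Union>a\<in>A. I a)" using assms(1) fI(1) by auto
  fix w assume w: "w permutes X" "r < cyc X w"
  have "{i. i \<in> (\<Union>a\<in>A. I a) \<and> cyc X (w \<circ> f i) + r = cyc X w} =
    (\<Union>a\<in>A. {i. i \<in> I a \<and> cyc X (w \<circ> f i) + r = cyc X w})" by auto
  then have "(\<Sum>i | i \<in> (\<Union>a\<in>A. I a) \<and> cyc X (w \<circ> f i) + r = cyc X w. cycle_weight X (w \<circ> f i)) =
    (\<Sum>a\<in>A. \<Sum>i | i \<in> I a \<and> cyc X (w \<circ> f i) + r = cyc X w. cycle_weight X (w \<circ> f i))"
    using assms(1) fI(1) disj by (simp only:) (subst sum.UNION_disjoint, auto, blast)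
  then show "(\<Sum>i | i \<in> (\<Union>a\<in>A. I a) \<and> cyc X (w \<circ> f i) + r = cyc X w. cycle_weight X (w \<circ> f i)) *
      fact (cyc X w - r - 1) = cycle_weight X w * fact (cyc X w - 1) * (\<Sum>a\<in>A. D a)"
    using fI(4)[OF _ w] by (simp add: sum_distrib_right sum_distrib_left)
qed (use uniform_familyD[OF assms(2)] in auto)

lemma uniform_family_id: "uniform_family X {x} (\<lambda>_. id) 0 1" if "finite X"
  by (simp add: uniform_family_def cyc_id)

lemma bij_betw_snoc:
  "bij_betw (\<lambda>(xs, x). xs @ [x])
    ({xs. length xs = d \<and> (\<forall>i<d. xs ! i \<in> A i)} \<times> A d) {xs. length xs = Suc d \<and> (\<forall>i<Suc d. xs ! i \<in> A i)}"
proof (rule bij_betw_byWitness[where f' = "\<lambda>xs. (butlast xs, last xs)"])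
  show "(\<lambda>xs. (butlast xs, last xs)) ` {xs. length xs = Suc d \<and> (\<forall>i<Suc d. xs ! i \<in> A i)}
    \<subseteq> {xs. length xs = d \<and> (\<forall>i<d. xs ! i \<in> A i)} \<times> A d"
  proof (rule image_subsetI)
    fix xs assume xs: "xs \<in> {xs. length xs = Suc d \<and> (\<forall>i<Suc d. xs ! i \<in> A i)}"
    then have "last xs = xs ! d" by (subst last_conv_nth) auto
    then show "(butlast xs, last xs) \<in> {xs. length xs = d \<and> (\<forall>i<d. xs ! i \<in> A i)} \<times> A d"
      using xs by (auto simp: nth_butlast)
  qed
  show "\<forall>xs\<in>{xs. length xs = Suc d \<and> (\<forall>i<Suc d. xs ! i \<in> A i)}.
    (case (butlast xs, last xs) of (xs, x) \<Rightarrow> xs @ [x]) = xs"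
    by (auto simp del: append_butlast_last_id intro!: append_butlast_last_id)
qed (auto simp: nth_append less_Suc_eq)

text \<open>The map \<open>g\<close> allows the entries to be permutations or whole blocks of
  permutations, each standing for its product.\<close>

lemma uniform_family_lists:
  assumes X: "finite X" and A: "\<And>i. i < d \<Longrightarrow> uniform_family X (A i) g (r i) (D i)"
  shows "uniform_family X {xs. length xs = d \<and> (\<forall>i<d. xs ! i \<in> A i)}
    (\<lambda>xs. perm_product (map g xs)) (\<Sum>i<d. r i) (\<Prod>i<d. D i)"
  using A
proof (induction d)
  case 0
  have "{xs :: 'b list. length xs = 0 \<and> (\<forall>i<0. xs ! i \<in> A i)} = {[]}" by auto
  then show ?case
    using uniform_family_reindex[OF uniform_family_id[OF X, of "[]"], of id "{[]}" "\<lambda>xs. perm_product (map g xs)"]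
    by (simp add: bij_betw_def)
next
  case (Suc d)
  have "uniform_family X ({xs. length xs = d \<and> (\<forall>i<d. xs ! i \<in> A i)} \<times> A d)
    (\<lambda>(xs, x). perm_product (map g xs) \<circ> g x) ((\<Sum>i<d. r i) + r d) ((\<Prod>i<d. D i) * D d)"
    using Suc by (intro uniform_family_prod X) auto
  then have "uniform_family X {xs. length xs = Suc d \<and> (\<forall>i<Suc d. xs ! i \<in> A i)}
    (\<lambda>xs. perm_product (map g xs)) ((\<Sum>i<d. r i) + r d) ((\<Prod>i<d. D i) * D d)"
    by (rule uniform_family_reindex[OF _ bij_betw_snoc]) (auto simp: perm_product_append)
  then show ?case by simp
qed

text \<open>The rule is applied to \<open>id\<close>, which has weight 1 and \<open>card X\<close>
  cycles; the products that contribute are full cycles, of weight \<open>card X\<close>.\<close>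

lemma card_cyclic_products:
  assumes X: "finite X" "X \<noteq> {}" and I: "uniform_family X I f (card X - 1) D"
  shows "real (card {i \<in> I. cyc X (f i) = 1}) * card X = fact (card X - 1) * D"
proof -
  note fI = uniform_familyD[OF I]
  have N: "card X > 0" using X by (simp add: card_gt_0_iff)
  have "(\<Sum>i | i \<in> I \<and> cyc X (id \<circ> f i) + (card X - 1) = cyc X id. cycle_weight X (id \<circ> f i)) =
    (\<Sum>i\<in>{i \<in> I. cyc X (f i) = 1}. real (card X))"
    using X fI(2) N by (intro sum.cong) (auto simp: cyc_id cycle_weight_cyclic)
  then show ?thesis
    using fI(4)[of id] N by (simp add: cyc_id cycle_weight_id)
qed

section \<open>Permutations of given cycle type or rank\<close>

text \<open>The count of completions is the base case of the criterion. The rank is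
  \<open>card X - size M\<close> because \<open>size M\<close> is the number of cycles.\<close>

lemma uniform_family_cycle_type:
  assumes X: "finite X" "X \<noteq> {}" and M: "sum_mset M = card X" "0 \<notin># M"
  shows "uniform_family X {\<sigma>. \<sigma> permutes X \<and> cycle_type X \<sigma> = M} (\<lambda>\<sigma>. \<sigma>) (card X - size M)
    (real (card X) * real (card (permutations_of_multiset M)) / real (size M))"
proof (rule uniform_familyI[OF X])
  show "finite {\<sigma>. \<sigma> permutes X \<and> cycle_type X \<sigma> = M}"
    by (rule finite_subset[OF _ finite_permutations[OF X(1)]]) auto
  fix \<sigma> assume s: "\<sigma> \<in> {\<sigma>. \<sigma> permutes X \<and> cycle_type X \<sigma> = M}"
  then show "\<sigma> permutes X" by simp
  have "size M = cyc X \<sigma>" using s cycle_type_basics(1)[of \<sigma> X] X by auto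
  then show "card X \<le> cyc X \<sigma> + (card X - size M)" by simp
next
  fix w assume w: "w permutes X" "cyc X w = Suc (card X - size M)"
  have "size M \<le> card X" using size_le_sum_mset M by metis
  then have "real (card (cyclic_completions X w M)) =
    cycle_weight X w * fact (cyc X w - 1) * real (card (permutations_of_multiset M)) / real (size M)"
    using w M X unfolding predicted_completions_def[symmetric] by (intro card_cyclic_completions) auto
  moreover have "{\<sigma> \<in> {\<sigma>. \<sigma> permutes X \<and> cycle_type X \<sigma> = M}. cyc X (w \<circ> \<sigma>) = 1} = cyclic_completions X w M"
    by (auto simp: cyclic_completions_def)
  ultimately show "real (card {\<sigma> \<in> {\<sigma>. \<sigma> permutes X \<and> cycle_type X \<sigma> = M}. cyc X (w \<circ> \<sigma>) = 1}) * real (card X) =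
    cycle_weight X w * fact (card X - size M) *
      (real (card X) * real (card (permutations_of_multiset M)) / real (size M))"
    using w(2) by simp
qed

text \<open>No permutation has more than \<open>card X\<close> cycles, so \<open>r < cyc X w\<close>
  never holds and every constant is admissible.\<close>

lemma uniform_family_vacuous:
  assumes "finite X" "finite I" "\<And>i. i \<in> I \<Longrightarrow> f i permutes X" "card X \<le> r"
  shows "uniform_family X I f r D"
  unfolding uniform_family_def
proof (intro conjI ballI allI impI)
  fix w assume "r < cyc X w"
  then show "(\<Sum>i | i \<in> I \<and> cyc X (w \<circ> f i) + r = cyc X w. cycle_weight X (w \<circ> f i)) * fact (cyc X w - r - 1) =
    cycle_weight X w * fact (cyc X w - 1) * D"
    using cyc_le_card[OF assms(1), of w] assms(4) by simp
qed (use assms in auto)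

lemma uniform_family_empty: "uniform_family X {} f r 0"
  by (simp add: uniform_family_def)

text \<open>Subtracting 1 from each part of a composition of \<open>N\<close> leaves
  \<open>l\<close> non-negative parts with sum \<open>N - l\<close>, which stars and bars
  counts.\<close>

lemma card_positive_lists:
  assumes "0 < l" "l \<le> N"
  shows "card {xs. length xs = l \<and> sum_list xs = N \<and> (0::nat) \<notin> set xs} = (N - 1) choose (N - l)"
proof -
  have "{xs. length xs = l \<and> sum_list xs = N \<and> (0::nat) \<notin> set xs} =
    map Suc ` {xs. length xs = l \<and> sum_list xs = N - l}"
  proof (intro set_eqI iffI)
    fix xs assume xs: "xs \<in> {xs. length xs = l \<and> sum_list xs = N \<and> (0::nat) \<notin> set xs}"
    then have e: "map Suc (map (\<lambda>x. x - 1) xs) = xs"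
      unfolding map_map comp_def by (intro map_idI) (auto, metis Suc_pred neq0_conv)
    have "sum_list (map Suc (map (\<lambda>x. x - 1) xs)) = sum_list (map (\<lambda>x. x - 1) xs) + length xs"
      by (induction xs) auto
    then have "sum_list (map (\<lambda>x. x - 1) xs) = N - l" using xs e by simp
    then show "xs \<in> map Suc ` {xs. length xs = l \<and> sum_list xs = N - l}"
      using xs e by (intro image_eqI[of _ _ "map (\<lambda>x. x - 1) xs"]) auto
  next
    fix xs assume "xs \<in> map Suc ` {xs. length xs = l \<and> sum_list xs = N - l}"
    then obtain ys where ys: "xs = map Suc ys" "length ys = l" "sum_list ys = N - l" by auto
    have "sum_list (map Suc ys) = sum_list ys + length ys" by (induction ys) auto
    then show "xs \<in> {xs. length xs = l \<and> sum_list xs = N \<and> (0::nat) \<notin> set xs}"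
      using ys assms by auto
  qed
  then have "card {xs. length xs = l \<and> sum_list xs = N \<and> (0::nat) \<notin> set xs} =
    card {xs. length xs = l \<and> sum_list xs = N - l}"
    by (simp add: card_image inj_on_def)
  also have "\<dots> = (N - l + l - 1) choose (N - l)" by (rule card_length_sum_list)
  finally show ?thesis using assms by simp
qed

text \<open>The constants of all cycle types with \<open>l = N - r\<close> cycles are added. The
  arrangements of these types are together the compositions of \<open>N\<close> into
  \<open>l\<close> parts, \<open>N - 1 choose r\<close> in number, and \<open>N / l\<close> times
  this is \<open>N choose r\<close>.\<close>

lemma uniform_family_rank:
  assumes X: "finite X" "X \<noteq> {}"
  shows "uniform_family X {\<sigma>. \<sigma> permutes X \<and> card X - cyc X \<sigma> = r} (\<lambda>\<sigma>. \<sigma>) r (real (card X choose r))"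
proof (cases "card X \<le> r")
  \<comment> \<open>For \<open>r = card X\<close> the binomial coefficient is 1 although no
    permutation has this rank; this does no harm, the rule being vacuous.\<close>
  case True
  show ?thesis
    by (rule uniform_family_vacuous[OF X(1) _ _ True])
      (auto intro: finite_subset[OF _ finite_permutations[OF X(1)]])
next
  case False
  define N where "N = card X"
  define l where "l = N - r"
  have l: "0 < l" "l \<le> N" "r = N - l" using False by (auto simp: l_def N_def)
  define Ls where "Ls = {xs. length xs = l \<and> sum_list xs = N \<and> (0::nat) \<notin> set xs}"
  have finL: "finite Ls"
  proof (rule finite_subset)
    show "Ls \<subseteq> {xs. set xs \<subseteq> {..N} \<and> length xs = l}"
      unfolding Ls_def using member_le_sum_list by fastforce
  qed (rule finite_lists_length_eq, simp)
  let ?I = "\<lambda>M. {\<sigma>. \<sigma> permutes X \<and> cycle_type X \<sigma> = M}"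
  have Ls: "sum_mset M = card X" "0 \<notin># M" "size M = l" if "M \<in> mset ` Ls" for M
    using that unfolding Ls_def N_def by (auto simp: sum_mset_sum_list)
  have "uniform_family X (\<Union>M\<in>mset ` Ls. ?I M) (\<lambda>\<sigma>. \<sigma>) r
    (\<Sum>M\<in>mset ` Ls. real N * real (card (permutations_of_multiset M)) / real l)"
  proof (rule uniform_family_Union)
    fix M assume M: "M \<in> mset ` Ls"
    show "uniform_family X (?I M) (\<lambda>\<sigma>. \<sigma>) r (real N * real (card (permutations_of_multiset M)) / real l)"
      using uniform_family_cycle_type[OF X Ls(1,2)[OF M]] Ls(3)[OF M] l(3) by (simp add: N_def)
  qed (use finL in auto)
  also have "(\<Union>M\<in>mset ` Ls. ?I M) = {\<sigma>. \<sigma> permutes X \<and> card X - cyc X \<sigma> = r}"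
  proof (intro set_eqI iffI)
    fix \<sigma> assume "\<sigma> \<in> (\<Union>M\<in>mset ` Ls. ?I M)"
    then have s: "\<sigma> permutes X" "cycle_type X \<sigma> \<in> mset ` Ls" by auto
    then have "cyc X \<sigma> = l" using Ls(3) cycle_type_basics(1)[OF s(1) X(1)] by metis
    then show "\<sigma> \<in> {\<sigma>. \<sigma> permutes X \<and> card X - cyc X \<sigma> = r}" using s l by (simp add: N_def)
  next
    fix \<sigma> assume "\<sigma> \<in> {\<sigma>. \<sigma> permutes X \<and> card X - cyc X \<sigma> = r}"
    then have s: "\<sigma> permutes X" "cyc X \<sigma> = l"
      using cyc_le_card[OF X(1), of \<sigma>] l False by (auto simp: N_def)
    obtain xs where xs: "cycle_type X \<sigma> = mset xs" by (metis ex_mset)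
    have "xs \<in> Ls"
      unfolding Ls_def N_def using cycle_type_basics[OF s(1) X(1)] s(2) xs
      by (auto simp: sum_mset_sum_list)
    then show "\<sigma> \<in> (\<Union>M\<in>mset ` Ls. ?I M)" using s xs by auto
  qed
  also have "(\<Sum>M\<in>mset ` Ls. real N * real (card (permutations_of_multiset M)) / real l) = real (card X choose r)"
  proof -
    \<comment> \<open>Every list in \<open>Ls\<close> is an arrangement of exactly one of these
      multisets.\<close>
    have "Ls = (\<Union>M\<in>mset ` Ls. permutations_of_multiset M)"
    proof -
      have "xs \<in> Ls" if "mset xs = mset ys" "ys \<in> Ls" for xs ys
        using that unfolding Ls_def
        by (metis (mono_tags, lifting) mem_Collect_eq mset_eq_setD size_mset sum_mset_sum_list)
      then show ?thesis by (auto simp: permutations_of_multiset_def)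
    qed
    then have "card Ls = card (\<Union>M\<in>mset ` Ls. permutations_of_multiset M)" by simp
    also have "\<dots> = (\<Sum>M\<in>mset ` Ls. card (permutations_of_multiset M))"
      using finL by (intro card_UN_disjoint) (auto, metis permutations_of_multisetD)
    finally have "(\<Sum>M\<in>mset ` Ls. card (permutations_of_multiset M)) = (N - 1) choose r"
      using card_positive_lists[OF l(1,2)] l(3) unfolding Ls_def by simp
    then have "(\<Sum>M\<in>mset ` Ls. real (card (permutations_of_multiset M))) = real ((N - 1) choose r)"
      by (simp flip: of_nat_sum)
    then have "(\<Sum>M\<in>mset ` Ls. real N * real (card (permutations_of_multiset M)) / real l) =
      real (N * ((N - 1) choose r)) / real l"
      by (simp flip: sum_distrib_left sum_divide_distrib)
    also have "N * ((N - 1) choose r) = l * (N choose r)"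
      using binomial_absorb_comp[of N r] by (simp add: l_def)
    finally show ?thesis using l(1) by (simp add: N_def)
  qed
  finally show ?thesis .
qed

text \<open>Lists are sorted by the rank \<open>r\<close> of their first entry; Vandermonde's
  identity adds up the products of the constants for this entry and for the rest.\<close>

lemma uniform_family_rank_lists:
  assumes X: "finite X" "X \<noteq> {}"
  shows "uniform_family X
    {xs. length xs = m \<and> set xs \<subseteq> {\<sigma>. \<sigma> permutes X} \<and> sum_list (map (\<lambda>\<sigma>. card X - cyc X \<sigma>) xs) = s}
    perm_product s (real ((m * card X) choose s))"
proof (induction m arbitrary: s)
  case 0
  show ?case
  proof (cases "s = 0")
    case True
    have "uniform_family X {[]} perm_product 0 1"
      by (rule uniform_family_reindex[OF uniform_family_id[OF X(1), of "[]"], of id])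
        (auto simp: bij_betw_def)
    moreover have "{xs. length xs = 0 \<and> set xs \<subseteq> {\<sigma>. \<sigma> permutes X} \<and>
        sum_list (map (\<lambda>\<sigma>. card X - cyc X \<sigma>) xs) = s} = {[]}" using True by auto
    ultimately show ?thesis using True by (simp only: mult_0 binomial_n_0 of_nat_1)
  next
    case False
    then have "{xs. length xs = 0 \<and> set xs \<subseteq> {\<sigma>. \<sigma> permutes X} \<and>
        sum_list (map (\<lambda>\<sigma>. card X - cyc X \<sigma>) xs) = s} = {}" by auto
    moreover have "0 choose s = 0" using False by (simp add: binomial_eq_0)
    ultimately show ?thesis using uniform_family_empty by (simp only: mult_0 of_nat_0)
  qed
next
  case (Suc m)
  let ?rk = "\<lambda>\<sigma>. card X - cyc X \<sigma>"
  let ?L = "\<lambda>m s. {xs. length xs = m \<and> set xs \<subseteq> {\<sigma>. \<sigma> permutes X} \<and> sum_list (map ?rk xs) = s}"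
  let ?R = "\<lambda>r. {\<sigma>. \<sigma> permutes X \<and> ?rk \<sigma> = r}"
  let ?J = "\<lambda>r. (\<lambda>(x, xs). x # xs) ` (?R r \<times> ?L m (s - r))"
  have "uniform_family X (\<Union>r\<in>{..s}. ?J r) perm_product s
    (\<Sum>r\<le>s. real (card X choose r) * real ((m * card X) choose (s - r)))"
  proof (rule uniform_family_Union)
    fix r assume "r \<in> {..s}"
    have "uniform_family X (?R r \<times> ?L m (s - r)) (\<lambda>(x, xs). x \<circ> perm_product xs) (r + (s - r))
      (real (card X choose r) * real ((m * card X) choose (s - r)))"
      by (intro uniform_family_prod X(1) uniform_family_rank[OF X] Suc.IH)
    then have "uniform_family X (?J r) perm_product (r + (s - r))
      (real (card X choose r) * real ((m * card X) choose (s - r)))"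
      by (rule uniform_family_reindex[where h = "\<lambda>(x, xs). x # xs"]) (auto simp: bij_betw_def inj_on_def)
    then show "uniform_family X (?J r) perm_product s
      (real (card X choose r) * real ((m * card X) choose (s - r)))"
      using \<open>r \<in> {..s}\<close> by simp
  qed auto
  also have "(\<Union>r\<in>{..s}. ?J r) = ?L (Suc m) s"
  proof (intro set_eqI iffI)
    fix xs assume "xs \<in> ?L (Suc m) s"
    then show "xs \<in> (\<Union>r\<in>{..s}. ?J r)"
      by (cases xs) (auto intro!: bexI[of _ "?rk (hd xs)"])
  qed auto
  also have "(\<Sum>r\<le>s. real (card X choose r) * real ((m * card X) choose (s - r))) =
    real ((Suc m * card X) choose s)"
    using arg_cong[OF vandermonde[of "card X" "m * card X" s], of real] by simp
  finally show ?case .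
qed

section \<open>The symmetric group\<close>

text \<open>A product of \<open>k\<close> transpositions has lost at most \<open>k\<close> of the
  \<open>n + 1\<close> cycles of \<open>id\<close>; building \<open>w\<close> by transpositions that
  all join cycles attains this bound.\<close>

lemma refl_length_eq:
  assumes w: "w \<in> W_A n"
  shows "refl_length n w = n + 1 - cyc {1..n+1} w"
proof -
  let ?X = "{1..n+1}"
  have w: "w permutes ?X" using w by (simp add: W_A_def)
  have lower: "perm_product ts permutes ?X \<and> n + 1 \<le> cyc ?X (perm_product ts) + length ts"
    if "set ts \<subseteq> reflections_A n" for ts
    using that
  proof (induction ts rule: rev_induct)
    case Nil
    show ?case using cyc_id[of ?X] unfolding perm_product_Nil by (simp only: permutes_id) simp
  next
    case (snoc t ts)
    then obtain a b where t: "t = transpose a b" "a \<in> ?X" "b \<in> ?X"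
      by (auto simp: reflections_A_def)
    have ts: "perm_product ts permutes ?X" "n + 1 \<le> cyc ?X (perm_product ts) + length ts"
      using snoc by auto
    have e: "perm_product (ts @ [t]) = perm_product ts \<circ> transpose a b"
      unfolding t(1) perm_product_append perm_product_Cons perm_product_Nil comp_id ..
    have "n + 1 \<le> cyc ?X (perm_product ts \<circ> transpose a b) + (length ts + 1)"
      using cyc_le_Suc_comp_transpose[OF ts(1) finite_atLeastAtMost t(2,3)] ts(2) by linarith
    then show ?case
      unfolding e using permutes_comp_transpose[OF ts(1) t(2,3)] by (simp only: length_append_singleton Suc_eq_plus1)
  qed
  have upper: "\<exists>ts. length ts + cyc ?X w = n + 1 \<and> set ts \<subseteq> reflections_A n \<and> perm_product ts = w"
    using w finite_atLeastAtMost
  proof (induction rule: permutes_rank_induct)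
    case id
    show ?case
      by (intro exI[of _ "[]"] conjI) (simp_all only: perm_product_Nil cyc_id, simp_all)
  next
    case (transpose \<tau> a b)
    then obtain ts where ts: "length ts + cyc ?X \<tau> = n + 1" "set ts \<subseteq> reflections_A n" "perm_product ts = \<tau>"
      by auto
    have "transpose a b \<in> reflections_A n"
      using transpose by (auto simp: reflections_A_def)
    then have "set (ts @ [transpose a b]) \<subseteq> reflections_A n" using ts(2) by simp
    moreover have "length (ts @ [transpose a b]) + cyc ?X (\<tau> \<circ> transpose a b) = n + 1"
      unfolding length_append_singleton using ts(1) transpose.hyps(5) by linarith
    moreover have "perm_product (ts @ [transpose a b]) = \<tau> \<circ> transpose a b"
      unfolding perm_product_append perm_product_Cons perm_product_Nil comp_id ts(3) ..
    ultimately show ?case by blast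
  qed
  show ?thesis
    unfolding refl_length_def
  proof (rule Least_equality)
    show "\<exists>ts. length ts = n + 1 - cyc ?X w \<and> set ts \<subseteq> reflections_A n \<and> perm_product ts = w"
      using upper by (metis add_diff_cancel_right')
    fix k assume "\<exists>ts. length ts = k \<and> set ts \<subseteq> reflections_A n \<and> perm_product ts = w"
    then show "n + 1 - cyc ?X w \<le> k" using lower by fastforce
  qed
qed

section \<open>Types as multisets of cycle lengths\<close>

lemma sum_mset_eq_sum_count:
  fixes M :: "nat multiset"
  assumes "finite A" "set_mset M \<subseteq> A"
  shows "sum_mset M = (\<Sum>j\<in>A. j * count M j)"
  using assms(2)
proof (induction M)
  case (add x M)
  have "(\<Sum>j\<in>A. j * count (add_mset x M) j) = (\<Sum>j\<in>A. j * count M j + (if j = x then x else 0))"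
    by (intro sum.cong) auto
  then show ?case using add assms(1) by (simp add: sum.distrib)
qed simp

lemma set_cycle_type_subset:
  assumes "\<sigma> permutes X" "finite X"
  shows "set_mset (cycle_type X \<sigma>) \<subseteq> {1..card X}"
proof
  fix k assume k: "k \<in># cycle_type X \<sigma>"
  then have "k \<le> sum_mset (cycle_type X \<sigma>)" by (metis le_add1 multi_member_split sum_mset.add_mset)
  then show "k \<in> {1..card X}"
    using cycle_type_basics[OF assms] k by (cases k) auto
qed

lemma sum_insert_1: "(\<Sum>j\<in>{1..n+1}. f j) = f 1 + (\<Sum>k=1..n. f (k + 1))"
  for f :: "nat \<Rightarrow> 'a::comm_monoid_add"
  using sum.atLeast_Suc_atMost[of 1 "n+1" f] sum.shift_bounds_cl_Suc_ivl[of f 1 n] by simp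

lemma prod_insert_1: "(\<Prod>j\<in>{1..n+1}. f j) = f 1 * (\<Prod>k=1..n. f (k + 1))"
  for f :: "nat \<Rightarrow> 'a::comm_monoid_mult"
  using prod.atLeast_Suc_atMost[of 1 "n+1" f] prod.shift_bounds_cl_Suc_ivl[of f 1 n] by simp

lemma has_type_iff:
  "has_type n \<sigma> t \<longleftrightarrow> \<sigma> permutes {1..n+1} \<and> (\<forall>k\<in>{1..n}. count (cycle_type {1..n+1} \<sigma>) (k + 1) = t k)"
  by (simp add: has_type_def W_A_def num_cycles_def count_cycle_type cycles_on_def del: One_nat_def)

text \<open>A type does not record fixed points; their number is what the longer cycles leave of the
  \<open>n + 1\<close> points. If these cycles need more points, the truncated difference is 0 and
  the entries add up to more than \<open>n + 1\<close>.\<close>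

definition type_mset :: "nat \<Rightarrow> (nat \<Rightarrow> nat) \<Rightarrow> nat multiset" where
  "type_mset n t = replicate_mset (n + 1 - (\<Sum>k=1..n. (k + 1) * t k)) 1 + (\<Sum>k=1..n. replicate_mset (t k) (k + 1))"

lemma count_type_mset_1: "count (type_mset n t) 1 = n + 1 - (\<Sum>k=1..n. (k + 1) * t k)"
  by (auto simp: type_mset_def count_sum intro!: sum.neutral)

lemma count_type_mset_Suc: "k \<in> {1..n} \<Longrightarrow> count (type_mset n t) (k + 1) = t k"
  by (simp add: type_mset_def count_sum)

lemma set_type_mset: "set_mset (type_mset n t) \<subseteq> {1..n+1}"
  by (auto simp: type_mset_def set_mset_sum split: if_splits)

lemma sum_mset_interval:
  assumes "set_mset M \<subseteq> {1..n+1}"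
  shows "sum_mset M = count M 1 + (\<Sum>k=1..n. (k + 1) * count M (k + 1))"
proof -
  have "sum_mset M = (\<Sum>j\<in>{1..n+1}. j * count M j)"
    by (rule sum_mset_eq_sum_count[OF finite_atLeastAtMost assms])
  then show ?thesis using sum_insert_1[of "\<lambda>j. j * count M j" n] by simp
qed

lemma sum_type_mset:
  assumes "(\<Sum>k=1..n. (k + 1) * t k) \<le> n + 1"
  shows "sum_mset (type_mset n t) = n + 1"
proof -
  have "(\<Sum>k=1..n. (k + 1) * count (type_mset n t) (k + 1)) = (\<Sum>k=1..n. (k + 1) * t k)"
    by (rule sum.cong[OF refl]) (simp only: count_type_mset_Suc)
  then show ?thesis
    using sum_mset_interval[OF set_type_mset, of n t] assms unfolding count_type_mset_1 by linarith
qed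

lemma sum_cycle_lengths:
  assumes "\<sigma> permutes {1..n+1}"
  shows "n + 1 = count (cycle_type {1..n+1} \<sigma>) 1 +
    (\<Sum>k=1..n. (k + 1) * count (cycle_type {1..n+1} \<sigma>) (k + 1))"
  using sum_mset_interval[of "cycle_type {1..n+1} \<sigma>" n] set_cycle_type_subset[OF assms]
    cycle_type_basics(2)[OF assms] by simp

lemma has_type_sum:
  assumes "has_type n \<sigma> t"
  shows "n + 1 = count (cycle_type {1..n+1} \<sigma>) 1 + (\<Sum>k=1..n. (k + 1) * t k)"
proof -
  have "(\<Sum>k=1..n. (k + 1) * count (cycle_type {1..n+1} \<sigma>) (k + 1)) = (\<Sum>k=1..n. (k + 1) * t k)"
    using assms unfolding has_type_iff by (intro sum.cong) auto
  moreover have "\<sigma> permutes {1..n+1}" using assms unfolding has_type_iff by blast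
  ultimately show ?thesis using sum_cycle_lengths[of \<sigma> n] by linarith
qed

text \<open>The type prescribes the multiplicities of the lengths from 2 to \<open>n + 1\<close>;
  the number of fixed points is then forced by the total, and no other length occurs.\<close>

lemma has_type_iff_cycle_type:
  "has_type n \<sigma> t \<longleftrightarrow>
    \<sigma> permutes {1..n+1} \<and> cycle_type {1..n+1} \<sigma> = type_mset n t" (is "?L \<longleftrightarrow> ?R")
proof
  let ?X = "{1..n+1}" and ?C = "cycle_type {1..n+1} \<sigma>"
  assume h: ?L
  then have \<sigma>: "\<sigma> permutes ?X" and c: "\<And>k. k \<in> {1..n} \<Longrightarrow> count ?C (k + 1) = t k"
    unfolding has_type_iff by auto
  have "?C = type_mset n t"
  proof (rule multiset_eqI)
    fix j
    consider "j \<notin> ?X" | "j = 1" | "j - 1 \<in> {1..n}" "j - 1 + 1 = j" by fastforce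
    then show "count ?C j = count (type_mset n t) j"
    proof cases
      case 1
      then have "j \<notin># ?C" "j \<notin># type_mset n t"
        using set_type_mset[of n t] set_cycle_type_subset[OF \<sigma>] by auto
      then show ?thesis by (simp add: not_in_iff)
    next
      case 2
      then show ?thesis using has_type_sum[OF h] count_type_mset_1[of n t] by simp
    next
      case 3
      then show ?thesis using c[OF 3(1)] count_type_mset_Suc[OF 3(1), of t] by simp
    qed
  qed
  then show ?R using \<sigma> by simp
next
  assume ?R
  then show ?L using count_type_mset_Suc[of _ n t] by (simp only: has_type_iff) simp
qed

lemma sum_Suc_type: "(\<Sum>k=1..n. (k + 1) * t k) = type_rank n t + (\<Sum>k=1..n. t k)"
  by (simp add: type_rank_def sum.distrib)

lemma size_type_mset:
  assumes "type_rank n t \<le> n" "(\<Sum>k=1..n. t k) \<le> n - type_rank n t + 1"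
  shows "size (type_mset n t) = n - type_rank n t + 1"
  using assms unfolding type_mset_def sum_Suc_type by (simp add: size_multiset_sum)

text \<open>The multinomial coefficient counts arrangements of the cycle lengths: its upper entry is
  the number of all cycles, and its remainder \<open>e\<close> is the number of fixed
  points.\<close>

lemma card_permutations_of_type_mset:
  assumes rk: "type_rank n t \<le> n" and le: "(\<Sum>k=1..n. t k) \<le> n - type_rank n t + 1"
  shows "real (card (permutations_of_multiset (type_mset n t))) = multinomial (n - type_rank n t + 1) n t"
proof -
  define s where "s = (\<Sum>k=1..n. t k)"
  define e where "e = n - type_rank n t + 1 - s"
  let ?M = "type_mset n t"
  have e1: "count ?M 1 = e" unfolding count_type_mset_1 sum_Suc_type e_def s_def using rk by simp
  have "(\<Prod>x\<in>set_mset ?M. fact (count ?M x)) = (\<Prod>x\<in>{1..n+1}. fact (count ?M x) :: real)"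
    using set_type_mset by (intro prod.mono_neutral_left) (auto simp: not_in_iff)
  also have "\<dots> = fact e * (\<Prod>k=1..n. fact (count ?M (k + 1)))"
    unfolding prod_insert_1 e1 ..
  also have "(\<Prod>k=1..n. fact (count ?M (k + 1))) = (\<Prod>k=1..n. fact (t k) :: real)"
    by (rule prod.cong[OF refl]) (simp only: count_type_mset_Suc)
  finally have p: "(\<Prod>x\<in>set_mset ?M. fact (count ?M x)) = fact e * (\<Prod>k=1..n. fact (t k) :: real)" .
  have "real (card (permutations_of_multiset ?M) * (\<Prod>x\<in>set_mset ?M. fact (count ?M x))) = real (fact (size ?M))"
    unfolding card_permutations_of_multiset_aux ..
  then have "real (card (permutations_of_multiset ?M)) * (fact e * (\<Prod>k=1..n. fact (t k))) =
      fact (n - type_rank n t + 1)"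
    using p unfolding size_type_mset[OF rk le] by (simp only: of_nat_mult of_nat_prod of_nat_fact)
  then have "real (card (permutations_of_multiset ?M)) =
      fact (n - type_rank n t + 1) / ((\<Prod>k=1..n. fact (t k)) * fact e)"
    by (subst nonzero_eq_divide_eq) (simp_all only: mult_ac, simp_all)
  then show ?thesis
    using le unfolding multinomial_def e_def s_def by (simp only: if_True)
qed

text \<open>The constant is \<open>n + 1\<close> times the factor that the type contributes to the
  final formula.\<close>

lemma uniform_family_has_type:
  assumes rk: "type_rank n t \<le> n"
  shows "uniform_family {1..n+1} {\<sigma>. has_type n \<sigma> t} (\<lambda>\<sigma>. \<sigma>) (type_rank n t)
    (real (n + 1) * (1 / real (n - type_rank n t + 1) * multinomial (n - type_rank n t + 1) n t))"
proof (cases "(\<Sum>k=1..n. t k) \<le> n - type_rank n t + 1")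
  case False
  \<comment> \<open>The cycles do not fit into \<open>n + 1\<close> points: no permutation has the
    type, in accordance with the value 0 of \<open>multinomial\<close>.\<close>
  have "\<not> has_type n \<sigma> t" for \<sigma>
    using has_type_sum[of n \<sigma> t] False unfolding sum_Suc_type by linarith
  then show ?thesis using False uniform_family_empty by (simp add: multinomial_def)
next
  case True
  let ?M = "type_mset n t"
  have "sum_mset ?M = n + 1"
    using True rk by (intro sum_type_mset) (simp only: sum_Suc_type)
  moreover have "0 \<notin># ?M" using set_type_mset[of n t] by auto
  moreover have "n + 1 - size ?M = type_rank n t" using size_type_mset[OF rk True] rk by simp
  ultimately show ?thesis
    using uniform_family_cycle_type[of "{1..n+1}" ?M] size_type_mset[OF rk True]
      card_permutations_of_type_mset[OF rk True] by (simp add: has_type_iff_cycle_type)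
qed

section \<open>Conjugation\<close>

text \<open>The iterates up to the first return to \<open>x\<close> are distinct and exhaust
  \<open>X\<close>, so the return time is \<open>card X\<close>.\<close>

lemma cyclic_on_bij_betw_funpow:
  assumes c: "cyclic_on c X" "x \<in> X"
  shows "bij_betw (\<lambda>i. (c ^^ i) x) {0..<card X} X" "(c ^^ card X) x = x"
proof -
  have o: "orbit c x = X" "x \<in> orbit c x" using orbit_cyclic_eq3[OF c] c(2) by auto
  have b: "bij_betw (\<lambda>i. (c ^^ i) x) {0..<funpow_dist1 c x x} X"
    using inj_on_funpow_dist1[OF o(2)] orbit_conv_funpow_dist1[OF o(2)] o(1) unfolding bij_betw_def by blast
  then have e: "funpow_dist1 c x x = card X" using bij_betw_same_card[OF b] by simp
  show "bij_betw (\<lambda>i. (c ^^ i) x) {0..<card X} X" using b unfolding e .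
  show "(c ^^ card X) x = x" using funpow_dist1_prop[OF o(2)] unfolding e .
qed

text \<open>Both cycles are written out from a common point \<open>x\<close>, and \<open>g\<close>
  sends the \<open>i\<close>-th iterate of \<open>c\<close> to the \<open>i\<close>-th iterate of
  \<open>c'\<close>.\<close>

lemma full_cycles_conjugate:
  assumes c: "c permutes X" "cyclic_on c X" and c': "c' permutes X" "cyclic_on c' X"
  obtains g where "g permutes X" "g \<circ> c \<circ> inv g = c'"
proof -
  obtain x where x: "x \<in> X" using c(2) by (auto simp: cyclic_on_def)
  let ?N = "card X" and ?h = "\<lambda>i. (c ^^ i) x" and ?h' = "\<lambda>i. (c' ^^ i) x"
  note b = cyclic_on_bij_betw_funpow[OF c(2) x] and b' = cyclic_on_bij_betw_funpow[OF c'(2) x]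
  define g where "g y = (if y \<in> X then ?h' (inv_into {0..<?N} ?h y) else y)" for y
  have N: "?N > 0" using x finite_cyclic_on[OF c(2)] by (auto simp: card_gt_0_iff)
  have gh: "g (?h i) = ?h' i" if "i < ?N" for i
  proof -
    have "?h i \<in> X" using bij_betwE[OF b(1)] that by auto
    moreover have "inv_into {0..<?N} ?h (?h i) = i"
      using that by (intro inv_into_f_f bij_betw_imp_inj_on[OF b(1)]) simp
    ultimately show ?thesis unfolding g_def by simp
  qed
  have "bij_betw (?h' \<circ> inv_into {0..<?N} ?h) X X"
    using bij_betw_trans[OF bij_betw_inv_into[OF b(1)] b'(1)] .
  then have "bij_betw g X X" by (rule bij_betw_cong[THEN iffD1, rotated]) (simp add: g_def)
  then have g: "g permutes X" by (rule bij_imp_permutes) (simp add: g_def)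
  have "g (c y) = c' (g y)" for y
  proof (cases "y \<in> X")
    case True
    then have "y \<in> ?h ` {0..<?N}" using bij_betw_imp_surj_on[OF b(1)] by blast
    then obtain i where i: "i < ?N" "y = ?h i" by auto
    show ?thesis
    proof (cases "Suc i < ?N")
      case True
      then show ?thesis using gh[of i] gh[of "Suc i"] i by simp
    next
      case False
      then have "?N = Suc i" using i by simp
      \<comment> \<open>After the last index both iterations return to \<open>x\<close>.\<close>
      then have "c y = ?h 0" "c' (?h' i) = ?h' 0" using b(2) b'(2) i by auto
      then show ?thesis using gh[of 0] gh[of i] N i by simp
    qed
  next
    case False
    then show ?thesis using permutes_not_in[OF c(1)] permutes_not_in[OF c'(1)] by (simp add: g_def)
  qed
  then have "g \<circ> c \<circ> inv g = c'"
    using permutes_inverses(1)[OF g] by (auto simp: fun_eq_iff)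
  then show ?thesis using that g by blast
qed

lemma cycles_on_conj:
  assumes "finite X" "g permutes X" "\<sigma> permutes X"
  shows "cycles_on X (g \<circ> \<sigma> \<circ> inv g) = (`) g ` cycles_on X \<sigma>"
proof -
  have "orbit (g \<circ> \<sigma> \<circ> inv g) (g x) = g ` orbit \<sigma> x" for x
    by (rule orbit_inverse[symmetric])
      (use permutes_self_in_orbit[OF assms(3,1)] permutes_inverses(2)[OF assms(2)] in auto)
  then have "(`) g ` cycles_on X \<sigma> = orbit (g \<circ> \<sigma> \<circ> inv g) ` g ` X"
    by (simp add: cycles_on_def image_image)
  then show ?thesis using permutes_image[OF assms(2)] by (simp add: cycles_on_def)
qed

lemma cycle_type_conj:
  assumes "finite X" "g permutes X" "\<sigma> permutes X"
  shows "cycle_type X (g \<circ> \<sigma> \<circ> inv g) = cycle_type X \<sigma>"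
proof -
  have inj: "inj g" by (rule permutes_inj[OF assms(2)])
  have "mset_set ((`) g ` cycles_on X \<sigma>) = image_mset ((`) g) (mset_set (cycles_on X \<sigma>))"
    by (rule image_mset_mset_set[symmetric]) (simp add: inj_on_def inj_image_eq_iff[OF inj])
  moreover have "card (g ` C) = card C" for C using inj by (simp add: card_image inj_on_subset)
  ultimately show ?thesis
    unfolding cycle_type_def cycles_on_conj[OF assms] by (simp add: image_mset.compositionality comp_def)
qed

lemma perm_product_conj:
  assumes "g permutes X"
  shows "perm_product (map (\<lambda>\<sigma>. g \<circ> \<sigma> \<circ> inv g) xs) = g \<circ> perm_product xs \<circ> inv g"
proof (induction xs)
  case Nil
  then show ?case using permutes_inv_o(1)[OF assms] by simp
next
  case (Cons x xs)
  have "perm_product (map (\<lambda>\<sigma>. g \<circ> \<sigma> \<circ> inv g) (x # xs)) = g \<circ> x \<circ> (inv g \<circ> g) \<circ> perm_product xs \<circ> inv g"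
    unfolding list.map perm_product_Cons Cons.IH by (simp only: comp_assoc)
  then show ?case
    by (simp only: permutes_inv_o(2)[OF assms] comp_id perm_product_Cons comp_assoc)
qed

text \<open>Conjugating all factors by \<open>g\<close> is injective and preserves cycle types,
  hence types and reflection lengths. Finiteness is assumed because an infinite set has cardinality
  0.\<close>

lemma card_factorisations_le_conj:
  assumes g: "g permutes {1..n+1}" and fin: "finite (factorisations n (g \<circ> c \<circ> inv g) d T l m s)"
  shows "card (factorisations n c d T l m s) \<le> card (factorisations n (g \<circ> c \<circ> inv g) d T l m s)"
proof (rule card_inj_on_le[OF _ _ fin])
  let ?X = "{1..n+1}"
  let ?\<phi> = "\<lambda>\<sigma>. g \<circ> \<sigma> \<circ> inv g"
  have perm: "?\<phi> \<sigma> \<in> W_A n" if "\<sigma> \<in> W_A n" for \<sigma>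
    using that g unfolding W_A_def by (auto intro!: permutes_compose permutes_inv)
  have type: "cycle_type ?X (?\<phi> \<sigma>) = cycle_type ?X \<sigma>" if "\<sigma> \<in> W_A n" for \<sigma>
    using that by (intro cycle_type_conj g) (auto simp: W_A_def)
  have len: "refl_length n (?\<phi> \<sigma>) = refl_length n \<sigma>" if "\<sigma> \<in> W_A n" for \<sigma>
    using type[OF that] perm[OF that] that cycle_type_basics(1)[of _ ?X]
    by (metis W_A_def finite_atLeastAtMost mem_Collect_eq refl_length_eq)
  have has: "has_type n (?\<phi> \<sigma>) t" if "has_type n \<sigma> t" for \<sigma> t
  proof -
    have W: "\<sigma> \<in> W_A n" using that by (simp add: has_type_def)
    show ?thesis
      using that perm[OF W] unfolding has_type_iff type[OF W] W_A_def by blast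
  qed
  have inj: "inj ?\<phi>"
  proof (rule injI)
    fix \<sigma> \<tau> assume "?\<phi> \<sigma> = ?\<phi> \<tau>"
    then have "inv g \<circ> ?\<phi> \<sigma> \<circ> g = inv g \<circ> ?\<phi> \<tau> \<circ> g" by simp
    then show "\<sigma> = \<tau>" using permutes_inverses(2)[OF g] by (simp add: fun_eq_iff)
  qed
  have "inj (map_prod (map ?\<phi>) (map (map ?\<phi>)))"
    by (intro prod.inj_map list.inj_map inj)
  then show "inj_on (map_prod (map ?\<phi>) (map (map ?\<phi>))) (factorisations n c d T l m s)"
    by (rule inj_on_subset) simp
  show "map_prod (map ?\<phi>) (map (map ?\<phi>)) ` factorisations n c d T l m s
    \<subseteq> factorisations n (?\<phi> c) d T l m s"
  proof (rule image_subsetI)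
    fix x assume "x \<in> factorisations n c d T l m s"
    then obtain ws bs where x: "x = (ws, bs)" "length ws = d" "set ws \<subseteq> W_A n" "length bs = l"
      "\<forall>i<l. length (bs ! i) = m i \<and> set (bs ! i) \<subseteq> W_A n" "c = perm_product (ws @ concat bs)"
      "\<forall>i<d. has_type n (ws ! i) (T i)" "\<forall>i<l. sum_list (map (refl_length n) (bs ! i)) = s i"
      unfolding factorisations_def by auto
    have "perm_product (map ?\<phi> ws @ concat (map (map ?\<phi>) bs)) = ?\<phi> c"
      unfolding x(6) perm_product_conj[OF g, symmetric] by (simp add: map_concat)
    moreover have "sum_list (map (refl_length n) (map ?\<phi> (bs ! i))) = s i" if "i < l" for i
    proof -
      have e: "map (refl_length n) (map ?\<phi> (bs ! i)) = map (refl_length n) (bs ! i)"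
        using x(5) that len by (auto simp: subset_iff)
      show ?thesis unfolding e using x(8) that by simp
    qed
    ultimately show "map_prod (map ?\<phi>) (map (map ?\<phi>)) x \<in> factorisations n (?\<phi> c) d T l m s"
    proof -
      assume p: "perm_product (map ?\<phi> ws @ concat (map (map ?\<phi>) bs)) = ?\<phi> c"
        and s: "\<And>i. i < l \<Longrightarrow> sum_list (map (refl_length n) (map ?\<phi> (bs ! i))) = s i"
      have "set (map ?\<phi> xs) \<subseteq> W_A n" if "set xs \<subseteq> W_A n" for xs
        using that perm unfolding set_map by blast
      moreover have "has_type n (map ?\<phi> ws ! i) (T i)" if "i < d" for i
        using that x(2,7) has by simp
      ultimately show ?thesis
        unfolding factorisations_def x(1) map_prod_simp mem_Collect_eq prod.case
        using x(2-5) p s by (simp del: map_map)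
    qed
  qed
qed

section \<open>Coxeter elements and the count for a fixed one\<close>

lemma cyclic_on_iff_cycles_on: "X \<noteq> {} \<Longrightarrow> cyclic_on c X \<longleftrightarrow> cycles_on X c = {X}"
  unfolding cyclic_on_alldef cycles_on_def by auto

lemma coxeter_elements_A_iff: "c \<in> coxeter_elements_A n \<longleftrightarrow> c permutes {1..n+1} \<and> cyc {1..n+1} c = 1"
proof (cases "c permutes {1..n+1}")
  case True
  have "cyclic_on c {1..n+1} \<longleftrightarrow> cycles_on {1..n+1} c = {{1..n+1}}"
    by (rule cyclic_on_iff_cycles_on) simp
  also have "\<dots> \<longleftrightarrow> cyc {1..n+1} c = 1" using cyc_eq_1_iff[OF True] by simp
  finally show ?thesis using True by (simp add: coxeter_elements_A_def W_A_def)
qed (simp add: coxeter_elements_A_def W_A_def)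

text \<open>Full cycles are the completions of \<open>id\<close> by the type with the single entry
  \<open>n + 1\<close>, so the formula for completions counts them.\<close>

lemma card_coxeter_elements_A: "card (coxeter_elements_A n) = fact n"
proof -
  let ?X = "{1..n+1}"
  have "cycle_type ?X c = {#n + 1#}" if "c permutes ?X" "cyc ?X c = 1" for c
    using cyc_eq_1_iff[OF that(1)] that(2) by (simp add: cycle_type_def)
  then have "coxeter_elements_A n = cyclic_completions ?X id {#n + 1#}"
    by (auto simp: coxeter_elements_A_iff cyclic_completions_def)
  also have "real (card \<dots>) = fact n"
    by (subst card_cyclic_completions) (simp_all add: predicted_completions_def cyc_id cycle_weight_id)
  finally show ?thesis by (metis of_nat_eq_iff of_nat_fact)
qed

theorem theorem8:
  fixes n d l :: nat
    and c :: "nat \<Rightarrow> nat"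
    and T :: "nat \<Rightarrow> nat \<Rightarrow> nat"
    and m s :: "nat \<Rightarrow> nat"
  assumes "n \<ge> 1" and "d \<ge> 1"
    and "c \<in> coxeter_elements_A n"
    and "(\<Sum>i<d. type_rank n (T i)) + (\<Sum>i<l. s i) = n"
  shows "real (card (factorisations n c d T l m s)) =
    real (n + 1) ^ (d - 1) *
    (\<Prod>i<d. 1 / real (n - type_rank n (T i) + 1) *
             multinomial (n - type_rank n (T i) + 1) n (T i)) *
    (\<Prod>i<l. real ((m i * (n + 1)) choose s i))"
proof -
  let ?X = "{1..n+1}"
  let ?mu = "\<lambda>i. 1 / real (n - type_rank n (T i) + 1) * multinomial (n - type_rank n (T i) + 1) n (T i)"
  define A where "A = {ws. length ws = d \<and> (\<forall>i<d. ws ! i \<in> {\<sigma>. has_type n \<sigma> (T i)})}"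
  define B where "B = {bs. length bs = l \<and> (\<forall>i<l. bs ! i \<in>
    {xs. length xs = m i \<and> set xs \<subseteq> {\<sigma>. \<sigma> permutes ?X} \<and> sum_list (map (\<lambda>\<sigma>. card ?X - cyc ?X \<sigma>) xs) = s i})}"
  \<comment> \<open>The identity map in the first product gives it the shape
    \<open>perm_product (map g xs)\<close> of the rule for lists.\<close>
  define f :: "(nat \<Rightarrow> nat) list \<times> (nat \<Rightarrow> nat) list list \<Rightarrow> nat \<Rightarrow> nat"
    where "f = (\<lambda>(ws, bs). perm_product (map (\<lambda>\<sigma>. \<sigma>) ws) \<circ> perm_product (map perm_product bs))"
  \<comment> \<open>A single rank is at most the total \<open>n\<close>, so
    \<open>n - type_rank n (T i)\<close> does not truncate.\<close>
  have rank: "type_rank n (T i) \<le> n" if "i < d" for i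
    using member_le_sum[of i "{..<d}" "\<lambda>i. type_rank n (T i)"] that assms(4) by simp
  have "uniform_family ?X A (\<lambda>ws. perm_product (map (\<lambda>\<sigma>. \<sigma>) ws)) (\<Sum>i<d. type_rank n (T i))
    (\<Prod>i<d. real (n + 1) * ?mu i)"
    unfolding A_def by (intro uniform_family_lists uniform_family_has_type rank) auto
  moreover have "uniform_family ?X B (\<lambda>bs. perm_product (map perm_product bs)) (\<Sum>i<l. s i)
    (\<Prod>i<l. real ((m i * card ?X) choose s i))"
    unfolding B_def by (intro uniform_family_lists uniform_family_rank_lists) auto
  ultimately have "uniform_family ?X (A \<times> B) f ((\<Sum>i<d. type_rank n (T i)) + (\<Sum>i<l. s i))
    ((\<Prod>i<d. real (n + 1) * ?mu i) * (\<Prod>i<l. real ((m i * card ?X) choose s i)))"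
    unfolding f_def by (intro uniform_family_prod) simp_all
  \<comment> \<open>By the hypothesis the ranks add up to \<open>n = card ?X - 1\<close>, the rank
    of a full cycle.\<close>
  then have U: "uniform_family ?X (A \<times> B) f n
    ((\<Prod>i<d. real (n + 1) * ?mu i) * (\<Prod>i<l. real ((m i * card ?X) choose s i)))"
    unfolding assms(4) .
  \<comment> \<open>Ranks are reflection lengths, and multiplying the products of the blocks
    multiplies out their concatenation.\<close>
  have fact_eq: "factorisations n c' d T l m s = {x \<in> A \<times> B. f x = c'}" for c'
  proof -
    have F: "f (ws, bs) = perm_product (ws @ concat bs)" for ws bs
      by (simp add: f_def perm_product_append perm_product_concat)
    have W: "set ws \<subseteq> W_A n" if "length ws = d" "\<forall>i<d. has_type n (ws ! i) (T i)" for ws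
      using that by (auto simp: in_set_conv_nth has_type_def)
    have rk: "map (\<lambda>\<sigma>. card ?X - cyc ?X \<sigma>) b = map (refl_length n) b" if "set b \<subseteq> W_A n" for b
      using that refl_length_eq by (auto simp: subset_iff)
    have WA: "{\<sigma>. \<sigma> permutes ?X} = W_A n" by (simp add: W_A_def)
    have A: "ws \<in> A \<longleftrightarrow> length ws = d \<and> (\<forall>i<d. has_type n (ws ! i) (T i))" for ws
      by (simp add: A_def)
    have B: "bs \<in> B \<longleftrightarrow> length bs = l \<and> (\<forall>i<l. length (bs ! i) = m i \<and> set (bs ! i) \<subseteq> W_A n \<and>
        sum_list (map (refl_length n) (bs ! i)) = s i)" for bs
      unfolding B_def WA mem_Collect_eq using rk by metis
    have "(ws, bs) \<in> factorisations n c' d T l m s \<longleftrightarrow> ws \<in> A \<and> bs \<in> B \<and> f (ws, bs) = c'" for ws bs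
      unfolding factorisations_def mem_Collect_eq prod.case A B F using W by metis
    then show ?thesis by (intro set_eqI) (simp only: split_paired_all mem_Collect_eq mem_Times_iff fst_conv snd_conv conj_assoc)
  qed
  have fin: "finite (factorisations n c' d T l m s)" for c'
    unfolding fact_eq using uniform_familyD(1)[OF U] by simp
  have conj: "card (factorisations n c' d T l m s) \<le> card (factorisations n c'' d T l m s)"
    if "c' \<in> coxeter_elements_A n" "c'' \<in> coxeter_elements_A n" for c' c''
  proof -
    have "c' permutes ?X" "cyclic_on c' ?X" "c'' permutes ?X" "cyclic_on c'' ?X"
      using that unfolding coxeter_elements_A_def W_A_def by auto
    then obtain g where "g permutes ?X" "g \<circ> c' \<circ> inv g = c''"
      by (rule full_cycles_conjugate)
    then show ?thesis using card_factorisations_le_conj[of g n c'] fin by metis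
  qed
  \<comment> \<open>An infinite set would have cardinality 0, which \<open>fact n\<close> is
    not.\<close>
  have fin_cox: "finite (coxeter_elements_A n)"
    using card_coxeter_elements_A[of n] by (metis card.infinite fact_nonzero)
  \<comment> \<open>The pairs whose product is some full cycle are sorted by this product.\<close>
  have "{x \<in> A \<times> B. cyc ?X (f x) = 1} = (\<Union>c'\<in>coxeter_elements_A n. factorisations n c' d T l m s)"
    using uniform_familyD(2)[OF U] unfolding fact_eq by (auto simp: coxeter_elements_A_iff)
  then have "card {x \<in> A \<times> B. cyc ?X (f x) = 1} =
    (\<Sum>c'\<in>coxeter_elements_A n. card (factorisations n c' d T l m s))"
    using fin fin_cox by (simp only:) (intro card_UN_disjoint, auto simp: fact_eq)
  \<comment> \<open>Conjugation in both directions gives the same count for every full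
    cycle.\<close>
  also have "\<dots> = (\<Sum>c'\<in>coxeter_elements_A n. card (factorisations n c d T l m s))"
    using conj assms(3) by (intro sum.cong antisym) auto
  finally have count: "card {x \<in> A \<times> B. cyc ?X (f x) = 1} = fact n * card (factorisations n c d T l m s)"
    by (simp add: card_coxeter_elements_A)
  have "real (card {x \<in> A \<times> B. cyc ?X (f x) = 1}) * real (card ?X) = fact (card ?X - 1) *
    ((\<Prod>i<d. real (n + 1) * ?mu i) * (\<Prod>i<l. real ((m i * card ?X) choose s i)))"
    using U by (intro card_cyclic_products) auto
  then have "real (card (factorisations n c d T l m s)) * real (n + 1) =
    (\<Prod>i<d. real (n + 1) * ?mu i) * (\<Prod>i<l. real ((m i * (n + 1)) choose s i))"
    unfolding count by simp
  also have "(\<Prod>i<d. real (n + 1) * ?mu i) = real (n + 1) ^ d * (\<Prod>i<d. ?mu i)"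
    by (simp only: prod.distrib prod_constant card_lessThan)
  \<comment> \<open>One of the \<open>d\<close> factors \<open>n + 1\<close> is split off to cancel
    against the number of points on the left; this is possible since
    \<open>d \<ge> 1\<close>.\<close>
  also have "real (n + 1) ^ d = real (n + 1) ^ (d - 1) * real (n + 1)"
    using assms(2) by (metis power_minus_mult Suc_le_eq One_nat_def)
  finally have "real (card (factorisations n c d T l m s)) * real (n + 1) =
    (real (n + 1) ^ (d - 1) * (\<Prod>i<d. ?mu i) * (\<Prod>i<l. real ((m i * (n + 1)) choose s i))) * real (n + 1)"
    by (simp only: mult_ac)
  then show ?thesis by (subst (asm) mult_cancel_right) simp
qed

end
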